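(* Let $\{A(t);t\ge0\}$ be a non-homogeneous Poisson process on $[0,\infty)$ with rate function $\lambda$. For each $s\ge0$ let $B_s$ be a nonnegative random variable (law depending on $s$) and $F_s$ a CDF on $[0,\infty)$. For each integer $n\ge1$ consider the infinite-server queue in which batches arrive at the points of $A$, a batch arriving at time $s$ has size $B^{(n)}_s:=\lceil nB_s\rceil$, and given its size the customers of that batch bring i.i.d. amounts of work with CDF $F_s$, all batches being independent of each other and of $A$; each customer arriving at time $s$ with work $S$ departs at time $s+S$, and the system starts empty. Let $Q_n(t)$ be the number of customers present at time $t$ and $D_n(t)$ the number of departures in $(0,t]$, and set $\overline{Q}_n(t)=Q_n(t)/n$, $\overline{D}_n(t)=D_n(t)/n$. Then for every integer $m\ge1$, all $0=t_0<t_1<\dots<t_m$ and all $\alpha,\beta\in\mathbb{R}_+^m$, $$\lim_{n\to\infty}\mathbb{E}\Big[e^{-\sum_{k=1}^m(\alpha_k\overline{Q}_n(t_k)+\beta_k\overline{D}_n(t_k))}\Big]=\exp\Big(-\sum_{k=1}^m\int_{t_{k-1}}^{t_k}\mathbb{E}_s\Big[1-e^{-\left(\sum_{x=k}^m\left(\alpha_x\overline{F}_s(t_x-s)+\beta_xF_s(t_x-s)\right)\right)B_s}\Big]\lambda(s)\,ds\Big),$$ where $\mathbb{E}_s$ denotes expectation with respect to the law of $B_s$ and $\overline{F}_s=1-F_s$.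
   Context: This describes a batch-scaling of infinite-server queues with non-stationary Poisson batch arrivals; the limit is the joint Laplace transform of a Poisson-driven shot-noise process $Z(t)=\int_0^tB_s\overline{F}_s(t-s)A(ds)$ and its complement evaluated at finitely many times. *)

theory Defs
  imports "HOL-Probability.Probability"
begin

text \<open>Sample paths of a counting process on [0,oo): start at 0, nondecreasing,
  right-continuous (for nat-valued paths: locally constant to the right).\<close>
definition counting_path :: "(real \<Rightarrow> nat) \<Rightarrow> bool" where
  "counting_path f \<longleftrightarrow> f 0 = 0 \<and> (\<forall>s t. 0 \<le> s \<longrightarrow> s \<le> t \<longrightarrow> f s \<le> f t) \<and>
     (\<forall>t\<ge>0. \<exists>d>0. \<forall>u. t \<le> u \<longrightarrow> u < t + d \<longrightarrow> f u = f t)"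

text \<open>Time of the (k+1)-st point (arrival) of a counting path (k counted from 0).\<close>
definition arr_time :: "(real \<Rightarrow> nat) \<Rightarrow> nat \<Rightarrow> real" where
  "arr_time f k = Inf {t. 0 \<le> t \<and> k < f t}"

definition poisson_process :: "'a measure \<Rightarrow> (real \<Rightarrow> real) \<Rightarrow> (real \<Rightarrow> 'a \<Rightarrow> nat) \<Rightarrow> bool" where
  "poisson_process M lam A \<longleftrightarrow>
     (\<forall>t. A t \<in> M \<rightarrow>\<^sub>M count_space UNIV) \<and>
     (\<forall>\<omega>\<in>space M. counting_path (\<lambda>t. A t \<omega>)) \<and>
     (\<forall>(r::nat) (s::nat \<Rightarrow> real). 0 \<le> s 0 \<longrightarrow> (\<forall>i<r. s i < s (Suc i)) \<longrightarrow>
        prob_space.indep_vars M (\<lambda>_. count_space UNIV) (\<lambda>i \<omega>. A (s (Suc i)) \<omega> - A (s i) \<omega>) {..<r}) \<and>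
     (\<forall>s t (j::nat). 0 \<le> s \<longrightarrow> s \<le> t \<longrightarrow>
        measure M {\<omega>\<in>space M. A t \<omega> - A s \<omega> = j} =
          (LINT u:{s..t}|lborel. lam u) ^ j / fact j * exp (- (LINT u:{s..t}|lborel. lam u)))"

text \<open>Mark of a batch arriving at time s: the base size B_s (law PB s) together with an
  i.i.d. sequence of work amounts (law W s each), independent of B_s.\<close>
definition mark_law :: "(real \<Rightarrow> real measure) \<Rightarrow> (real \<Rightarrow> real measure) \<Rightarrow> real \<Rightarrow> (real \<times> (nat \<Rightarrow> real)) measure" where
  "mark_law PB W s = PB s \<Otimes>\<^sub>M (\<Pi>\<^sub>M j\<in>(UNIV::nat set). W s)"

definition mark_space :: "(real \<times> (nat \<Rightarrow> real)) measure" where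
  "mark_space = borel \<Otimes>\<^sub>M (\<Pi>\<^sub>M j\<in>(UNIV::nat set). (borel :: real measure))"

definition path_space :: "(real \<Rightarrow> nat) measure" where
  "path_space = (\<Pi>\<^sub>M t\<in>(UNIV::real set). count_space (UNIV::nat set))"

text \<open>Marked Poisson arrival stream: A is a Poisson process of rate lam; the k-th batch
  carries mark (Bm k, S k).  Conditionally on the whole path of A, the marks of the
  batches are independent, the mark of a batch arriving at time s having law
  mark_law PB W s.  (Stated via the defining identity of conditional laws, on events
  where at least K arrivals occur.)\<close>
definition marked_arrivals ::
  "'a measure \<Rightarrow> (real \<Rightarrow> real) \<Rightarrow> (real \<Rightarrow> real measure) \<Rightarrow> (real \<Rightarrow> real measure) \<Rightarrow>
   (real \<Rightarrow> 'a \<Rightarrow> nat) \<Rightarrow> (nat \<Rightarrow> 'a \<Rightarrow> real) \<Rightarrow> (nat \<Rightarrow> nat \<Rightarrow> 'a \<Rightarrow> real) \<Rightarrow> bool" where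
  "marked_arrivals M lam PB W A Bm S \<longleftrightarrow>
     prob_space M \<and> poisson_process M lam A \<and>
     (\<forall>k. (\<lambda>\<omega>. (Bm k \<omega>, \<lambda>j. S k j \<omega>)) \<in> M \<rightarrow>\<^sub>M mark_space) \<and>
     (\<forall>(K::nat) E C. E \<in> sets path_space \<longrightarrow> E \<subseteq> {f. \<exists>t\<ge>0. K \<le> f t} \<longrightarrow>
        (\<forall>k<K. C k \<in> sets mark_space) \<longrightarrow>
        measure M {\<omega>\<in>space M. (\<lambda>t. A t \<omega>) \<in> E \<and> (\<forall>k<K. (Bm k \<omega>, \<lambda>j. S k j \<omega>) \<in> C k)} =
        (\<integral>\<omega>. indicator E (\<lambda>t. A t \<omega>) *
              (\<Prod>k<K. measure (mark_law PB W (arr_time (\<lambda>t. A t \<omega>) k)) (C k)) \<partial>M))"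

definition queue_len :: "nat \<Rightarrow> (real \<Rightarrow> 'a \<Rightarrow> nat) \<Rightarrow> (nat \<Rightarrow> 'a \<Rightarrow> real) \<Rightarrow> (nat \<Rightarrow> nat \<Rightarrow> 'a \<Rightarrow> real) \<Rightarrow> real \<Rightarrow> 'a \<Rightarrow> nat" where
  "queue_len n A Bm S t \<omega> =
     (\<Sum>k<A t \<omega>. card {j. j < nat \<lceil>real n * Bm k \<omega>\<rceil> \<and>
        t < arr_time (\<lambda>u. A u \<omega>) k + S k j \<omega>})"

definition departures :: "nat \<Rightarrow> (real \<Rightarrow> 'a \<Rightarrow> nat) \<Rightarrow> (nat \<Rightarrow> 'a \<Rightarrow> real) \<Rightarrow> (nat \<Rightarrow> nat \<Rightarrow> 'a \<Rightarrow> real) \<Rightarrow> real \<Rightarrow> 'a \<Rightarrow> nat" where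
  "departures n A Bm S t \<omega> =
     (\<Sum>k<A t \<omega>. card {j. j < nat \<lceil>real n * Bm k \<omega>\<rceil> \<and>
        0 < arr_time (\<lambda>u. A u \<omega>) k + S k j \<omega> \<and> arr_time (\<lambda>u. A u \<omega>) k + S k j \<omega> \<le> t})"

definition cdf_of :: "real measure \<Rightarrow> real \<Rightarrow> real" where
  "cdf_of P x = measure P {..x}"

end

theory Submission
  imports Defs
begin

text \<open>Up to the last observation time \<open>T\<close> the exponential is a product over the arrivals of a
  weight \<open>h\<close> in \<open>[0,1]\<close> depending on the arrival time and the mark. Conditioning on the path of
  the Poisson process replaces \<open>h(s, mark)\<close> by \<open>G s\<close>, its integral against the mark law at
  time \<open>s\<close>, and the Poisson functional \<open>E (\<Prod> G(arrival)) = exp (- \<integral>\<^sub>0\<^sup>T (1 - G s) lam s ds)\<close> gives the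
  prelimit transform explicitly. That functional follows from independent increments when \<open>G\<close> is
  a step function; Campbell's formula \<open>E (\<Sum> g(arrival)) = \<integral>\<^sub>0\<^sup>T g s lam s ds\<close> makes both of its
  sides continuous in \<open>L\<^sup>1(lam ds)\<close>, where step functions are dense. Finally, for a batch
  arriving at \<open>s\<close> the weight integrates to the expectation of
  \<open>(E exp (- cost / n)) ^ \<lceil>n B\<rceil>\<close>, which tends to that of \<open>exp (- B * E cost)\<close>, so that
  dominated convergence applies.\<close>

section \<open>Counting paths and Poisson increments\<close>

text \<open>Two obstacles shape the development. First, the model fixes conditional laws only
  through events of the whole path combined with finitely many mark events, while an arrival time
  depends on uncountably many coordinates of an element of \<open>path_space\<close>.
  Right-continuity helps here: once more than k points occur, \<open>arr_time f k\<close> is at most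
  \<open>a\<close> exactly when the count at \<open>a\<close> exceeds k, so on the sample space
  arrival times are measurable with respect to the path after all. Second, the weight of a batch
  does not factor into a function of its arrival time and a function of its mark, so an identity on
  rectangles has to be extended to joint functions, one batch at a time, by uniqueness of measures.
  In the limit, the transform of one customer's scaled cost is
  \<open>1 - c / n + O(1 / n^2)\<close>, \<open>c\<close> being its mean, and about
  \<open>n * B\<close> such factors leave \<open>exp (- B * c)\<close>: the randomness of the works
  averages out within a batch, that of the batch size does not.\<close>

lemma counting_path_mono: "counting_path f \<Longrightarrow> 0 \<le> s \<Longrightarrow> s \<le> t \<Longrightarrow> f s \<le> f t"
  unfolding counting_path_def by blast

lemma counting_path_0: "counting_path f \<Longrightarrow> f 0 = 0"
  unfolding counting_path_def by blast

text \<open>Right-continuity makes the infimum attained, so a bound on an arrival time is a bound on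
  a count; measurability, Campbell's formula and the decomposition into cells all rest on this. The
  hypothesis \<open>k < f T\<close> keeps the infimum away from the empty set.\<close>

lemma arr_time_le_iff:
  assumes f: "counting_path f" and "0 \<le> T" "k < f T" "0 \<le> a"
  shows "arr_time f k \<le> a \<longleftrightarrow> k < f a"
proof
  assume "k < f a"
  then show "arr_time f k \<le> a"
    unfolding arr_time_def using \<open>0 \<le> a\<close>
    by (intro cInf_lower) (auto intro!: bdd_belowI[of _ 0])
next
  assume le: "arr_time f k \<le> a"
  show "k < f a"
  proof (rule ccontr)
    assume n: "\<not> k < f a"
    from f \<open>0 \<le> a\<close> obtain d where d: "d > 0" "\<And>u. a \<le> u \<Longrightarrow> u < a + d \<Longrightarrow> f u = f a"
      unfolding counting_path_def by blast
    \<comment> \<open>The count stays at \<open>f a\<close> until \<open>a + d\<close>, so every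
      time with more than \<open>k\<close> points lies at or beyond \<open>a + d\<close>, strictly
      above \<open>a\<close>.\<close>
    have "a + d \<le> u" if "0 \<le> u" "k < f u" for u
    proof (rule ccontr)
      assume "\<not> a + d \<le> u"
      then have "f u \<le> f a"
        using d(2)[of u] counting_path_mono[OF f, of u a] that by (cases "a \<le> u") auto
      with n that show False by simp
    qed
    then have "a + d \<le> arr_time f k"
      unfolding arr_time_def using assms(2,3) by (intro cInf_greatest) auto
    with le d(1) show False by simp
  qed
qed

text \<open>No point sits at time 0, so arrivals fall into cells that are open on the left and
  closed on the right, starting at 0.\<close>

lemma arr_time_pos:
  assumes "counting_path f" "0 \<le> T" "k < f T"
  shows "0 < arr_time f k"
  using arr_time_le_iff[OF assms, of 0] counting_path_0[OF assms(1)] by simp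

lemma arr_time_le:
  assumes "counting_path f" "0 \<le> T" "k < f T"
  shows "arr_time f k \<le> T"
  using arr_time_le_iff[OF assms assms(2)] assms(3) by simp

text \<open>If no more than \<open>k\<close> points ever occur, \<open>arr_time\<close> is the infimum of the empty set; the
  truncation at \<open>T\<close> removes these junk values.\<close>
definition trunc_arr :: "(real \<Rightarrow> 'a \<Rightarrow> nat) \<Rightarrow> real \<Rightarrow> nat \<Rightarrow> 'a \<Rightarrow> real" where
  "trunc_arr A T k \<omega> = (if k < A T \<omega> then arr_time (\<lambda>u. A u \<omega>) k else 0)"

text \<open>The source is an arbitrary \<open>F\<close> because the lemma serves twice: for the
  probability space itself, and for the sigma-algebra generated by the path when the path events of
  the model are built.\<close>

lemma trunc_arr_measurable:
  assumes A [measurable]: "\<And>t. A t \<in> F \<rightarrow>\<^sub>M count_space UNIV"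
    and path: "\<And>\<omega>. \<omega> \<in> space F \<Longrightarrow> counting_path (\<lambda>u. A u \<omega>)"
    and T: "0 \<le> T"
  shows "trunc_arr A T k \<in> borel_measurable F"
proof (rule borel_measurable_iff_le[THEN iffD2], intro allI)
  fix a :: real
  show "{\<omega> \<in> space F. trunc_arr A T k \<omega> \<le> a} \<in> sets F"
  proof (cases "0 \<le> a")
    case True
    \<comment> \<open>The implication covers the default: when \<open>k\<close> is not below
      \<open>A T \<omega>\<close> the value is 0, which is at most \<open>a\<close>.\<close>
    then have "{\<omega> \<in> space F. trunc_arr A T k \<omega> \<le> a} =
        {\<omega> \<in> space F. k < A T \<omega> \<longrightarrow> k < A a \<omega>}"
      using arr_time_le_iff[OF path T, of _ k a] by (auto simp: trunc_arr_def)
    then show ?thesis by simp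
  next
    case False
    have "trunc_arr A T k \<omega> \<ge> 0" if "\<omega> \<in> space F" for \<omega>
      using arr_time_pos[OF path[OF that] T, of k] by (auto simp: trunc_arr_def)
    with False have "{\<omega> \<in> space F. trunc_arr A T k \<omega> \<le> a} = {}"
      by force
    then show ?thesis by (simp only: sets.empty_sets)
  qed
qed

section \<open>Generating function and mean of the Poisson increments\<close>

locale poisson_stream = prob_space M for M :: "'a measure" +
  fixes lam :: "real \<Rightarrow> real" and A :: "real \<Rightarrow> 'a \<Rightarrow> nat"
  assumes poisson: "poisson_process M lam A"
    and lam_meas [measurable]: "lam \<in> borel_measurable borel"
    and lam_nonneg: "0 \<le> s \<Longrightarrow> 0 \<le> lam s"
    and lam_loc_int: "0 \<le> T \<Longrightarrow> set_integrable lborel {0..T} lam"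
begin

abbreviation cum_rate :: "real \<Rightarrow> real \<Rightarrow> real" where
  "cum_rate s t \<equiv> (LINT u:{s..t}|lborel. lam u)"

lemma A_measurable [measurable]: "A t \<in> M \<rightarrow>\<^sub>M count_space UNIV"
  using poisson unfolding poisson_process_def by blast

lemma path: "\<omega> \<in> space M \<Longrightarrow> counting_path (\<lambda>u. A u \<omega>)"
  using poisson unfolding poisson_process_def by blast

lemma cum_rate_nonneg: "0 \<le> s \<Longrightarrow> 0 \<le> cum_rate s t"
  unfolding set_lebesgue_integral_def
  by (intro integral_nonneg_AE AE_I2) (auto simp: indicator_def lam_nonneg)

lemma increment_emeasure:
  assumes "0 \<le> s" "s \<le> t"
  shows "emeasure M {\<omega>\<in>space M. A t \<omega> - A s \<omega> = j} =
    ennreal (cum_rate s t ^ j / fact j * exp (- cum_rate s t))"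
  using poisson assms unfolding poisson_process_def emeasure_eq_measure by simp

lemma nn_integral_increment:
  fixes f :: "nat \<Rightarrow> ennreal"
  assumes "0 \<le> s" "s \<le> t"
  shows "(\<integral>\<^sup>+\<omega>. f (A t \<omega> - A s \<omega>) \<partial>M) =
    (\<Sum>j. f j * ennreal (cum_rate s t ^ j / fact j * exp (- cum_rate s t)))"
proof -
  have "f (A t \<omega> - A s \<omega>) = (\<Sum>j. f j * indicator {\<omega>\<in>space M. A t \<omega> - A s \<omega> = j} \<omega>)"
    if "\<omega> \<in> space M" for \<omega>
  proof -
    have "(\<Sum>j. f j * indicator {\<omega>\<in>space M. A t \<omega> - A s \<omega> = j} \<omega>) =
      (\<Sum>j\<in>{A t \<omega> - A s \<omega>}. f j * indicator {\<omega>\<in>space M. A t \<omega> - A s \<omega> = j} \<omega>)"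
      by (rule suminf_finite) (auto simp: indicator_def)
    then show ?thesis using that by simp
  qed
  then have "(\<integral>\<^sup>+\<omega>. f (A t \<omega> - A s \<omega>) \<partial>M) =
      (\<integral>\<^sup>+\<omega>. (\<Sum>j. f j * indicator {\<omega>\<in>space M. A t \<omega> - A s \<omega> = j} \<omega>) \<partial>M)"
    by (intro nn_integral_cong)
  also have "\<dots> = (\<Sum>j. f j * emeasure M {\<omega>\<in>space M. A t \<omega> - A s \<omega> = j})"
    by (subst nn_integral_suminf) (simp_all add: nn_integral_cmult_indicator)
  finally show ?thesis
    by (simp only: increment_emeasure[OF assms])
qed

lemma increment_pgf:
  assumes "0 \<le> s" "s \<le> t" "0 \<le> c"
  shows "(\<integral>\<^sup>+\<omega>. ennreal (c ^ (A t \<omega> - A s \<omega>)) \<partial>M) = ennreal (exp (- (1 - c) * cum_rate s t))"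
proof -
  let ?L = "cum_rate s t"
  have L: "0 \<le> ?L" by (rule cum_rate_nonneg) fact
  have "(\<lambda>j. (c * ?L) ^ j /\<^sub>R fact j * exp (- ?L)) sums (exp (c * ?L) * exp (- ?L))"
    by (intro sums_mult2 exp_converges)
  then have *: "(\<lambda>j. c ^ j * (?L ^ j / fact j * exp (- ?L))) sums exp (- (1 - c) * ?L)"
    by (simp add: power_mult_distrib field_simps flip: exp_add)
  have "(\<integral>\<^sup>+\<omega>. ennreal (c ^ (A t \<omega> - A s \<omega>)) \<partial>M) =
      (\<Sum>j. ennreal (c ^ j * (?L ^ j / fact j * exp (- ?L))))"
    using assms L by (subst nn_integral_increment)
      (auto intro!: suminf_cong ennreal_mult[symmetric] simp del: times_divide_eq_right)
  also have "\<dots> = ennreal (\<Sum>j. c ^ j * (?L ^ j / fact j * exp (- ?L)))"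
    using assms L * by (intro suminf_ennreal2) (auto simp: sums_iff)
  finally show ?thesis using * by (simp add: sums_iff)
qed

lemma increment_mean:
  assumes "0 \<le> s" "s \<le> t"
  shows "(\<integral>\<^sup>+\<omega>. of_nat (A t \<omega> - A s \<omega>) \<partial>M) = ennreal (cum_rate s t)"
proof -
  let ?L = "cum_rate s t"
  have L: "0 \<le> ?L" by (rule cum_rate_nonneg) fact
  have "(\<lambda>j. ?L * exp (- ?L) * (?L ^ j /\<^sub>R fact j)) sums (?L * exp (- ?L) * exp ?L)"
    by (intro sums_mult exp_converges)
  moreover have "?L * exp (- ?L) * (?L ^ j /\<^sub>R fact j) =
      real (Suc j) * (?L ^ Suc j / fact (Suc j) * exp (- ?L))" for j
    by (simp add: divide_simps del: of_nat_Suc)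
  ultimately have "(\<lambda>j. real (Suc j) * (?L ^ Suc j / fact (Suc j) * exp (- ?L))) sums ?L"
    by (simp only: mult.assoc flip: exp_add) simp
  \<comment> \<open>The index shift is free because the term at 0 vanishes.\<close>
  then have *: "(\<lambda>j. real j * (?L ^ j / fact j * exp (- ?L))) sums ?L"
    by (subst (asm) sums_Suc_iff) simp
  have "(\<integral>\<^sup>+\<omega>. of_nat (A t \<omega> - A s \<omega>) \<partial>M) =
      (\<Sum>j. ennreal (real j * (?L ^ j / fact j * exp (- ?L))))"
    using assms L by (subst nn_integral_increment)
      (auto intro!: suminf_cong ennreal_mult[symmetric]
        simp: ennreal_of_nat_eq_real_of_nat simp del: times_divide_eq_right)
  also have "\<dots> = ennreal (\<Sum>j. real j * (?L ^ j / fact j * exp (- ?L)))"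
    using assms L * by (intro suminf_ennreal2) (auto simp: sums_iff)
  finally show ?thesis using * by (simp add: sums_iff)
qed

end

section \<open>Campbell's formula\<close>

text \<open>The measure on the left is the mean measure of the arrivals up to \<open>T\<close>:
  counting measure on the indices times \<open>M\<close>, restricted to indices that occur, mapped
  to the arrival time. Writing a random sum as an integral against a measure reduces its comparison
  with the rate to half-lines.\<close>

lemma nn_integral_arr_series:
  assumes A: "\<And>t. A t \<in> M \<rightarrow>\<^sub>M count_space UNIV"
    and path: "\<And>\<omega>. \<omega> \<in> space M \<Longrightarrow> counting_path (\<lambda>u. A u \<omega>)"
    and T: "0 \<le> T" and "sigma_finite_measure M"
    and h [measurable]: "h \<in> borel_measurable borel"
  shows "(\<integral>\<^sup>+s. h s \<partial>distr (density (count_space UNIV \<Otimes>\<^sub>M M) (\<lambda>(k, \<omega>). indicator {..<A T \<omega>} k))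
        borel (\<lambda>(k, \<omega>). trunc_arr A T k \<omega>)) =
    (\<integral>\<^sup>+\<omega>. (\<Sum>k<A T \<omega>. h (arr_time (\<lambda>u. A u \<omega>) k)) \<partial>M)"
proof -
  interpret M: sigma_finite_measure M by fact
  interpret pair_sigma_finite "count_space (UNIV :: nat set)" M
    by (simp add: pair_sigma_finite_def M.sigma_finite_measure_axioms sigma_finite_measure_count_space)
  note A [measurable]
  have tr [measurable]: "trunc_arr A T k \<in> borel_measurable M" for k
    by (rule trunc_arr_measurable) (use A path T in auto)
  have [measurable]: "(\<lambda>(k, \<omega>). trunc_arr A T k \<omega>) \<in> borel_measurable (count_space UNIV \<Otimes>\<^sub>M M)"
    by (rule measurable_pair_measure_countable1) auto
  have [measurable]: "(\<lambda>(k, \<omega>). indicator {..<A T \<omega>} k :: ennreal) \<in> borel_measurable (count_space UNIV \<Otimes>\<^sub>M M)"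
    by (rule measurable_pair_measure_countable1) (auto simp: indicator_def)
  have "(\<integral>\<^sup>+s. h s \<partial>distr (density (count_space UNIV \<Otimes>\<^sub>M M) (\<lambda>(k, \<omega>). indicator {..<A T \<omega>} k))
        borel (\<lambda>(k, \<omega>). trunc_arr A T k \<omega>)) =
      (\<integral>\<^sup>+x. (case x of (k, \<omega>) \<Rightarrow> indicator {..<A T \<omega>} k * h (trunc_arr A T k \<omega>)) \<partial>(count_space UNIV \<Otimes>\<^sub>M M))"
    by (subst nn_integral_distr, measurable, subst nn_integral_density)
      (auto simp: case_prod_beta' intro!: nn_integral_cong)
  also have "\<dots> = (\<integral>\<^sup>+\<omega>. (\<integral>\<^sup>+k. indicator {..<A T \<omega>} k * h (trunc_arr A T k \<omega>) \<partial>count_space UNIV) \<partial>M)"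
    by (subst nn_integral_snd[symmetric]) (auto simp: case_prod_beta')
  also have "\<dots> = (\<integral>\<^sup>+\<omega>. (\<Sum>k<A T \<omega>. h (arr_time (\<lambda>u. A u \<omega>) k)) \<partial>M)"
  proof (rule nn_integral_cong)
    fix \<omega>
    have "(\<integral>\<^sup>+k. indicator {..<A T \<omega>} k * h (trunc_arr A T k \<omega>) \<partial>count_space UNIV) =
      (\<Sum>k. indicator {..<A T \<omega>} k * h (trunc_arr A T k \<omega>))"
      by (rule nn_integral_count_space_nat)
    also have "\<dots> = (\<Sum>k<A T \<omega>. indicator {..<A T \<omega>} k * h (trunc_arr A T k \<omega>))"
      by (rule suminf_finite) auto
    finally show "(\<integral>\<^sup>+k. indicator {..<A T \<omega>} k * h (trunc_arr A T k \<omega>) \<partial>count_space UNIV) =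
      (\<Sum>k<A T \<omega>. h (arr_time (\<lambda>u. A u \<omega>) k))"
      by (simp add: trunc_arr_def)
  qed
  finally show ?thesis .
qed

context poisson_stream
begin

lemma trunc_arr_borel [measurable]: "0 \<le> T \<Longrightarrow> trunc_arr A T k \<in> borel_measurable M"
  by (rule trunc_arr_measurable) (auto simp: path)

lemma nn_cum_rate:
  assumes "0 \<le> T"
  shows "(\<integral>\<^sup>+s. indicator {0..T} s * ennreal (lam s) \<partial>lborel) = ennreal (cum_rate 0 T)"
proof -
  have "(\<integral>\<^sup>+s. indicator {0..T} s * ennreal (lam s) \<partial>lborel) =
      (\<integral>\<^sup>+s. ennreal (indicator {0..T} s *\<^sub>R lam s) \<partial>lborel)"
    by (intro nn_integral_cong) (auto simp: indicator_def)
  also have "\<dots> = ennreal (cum_rate 0 T)"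
    unfolding set_lebesgue_integral_def
    using lam_loc_int[OF assms] unfolding set_integrable_def
    by (intro nn_integral_eq_integral) (auto simp: indicator_def lam_nonneg)
  finally show ?thesis .
qed

text \<open>Both sides are integrals of \<open>h\<close>, against the mean measure \<open>N\<close>
  of the arrivals and against the rate density \<open>L\<close>. Half-lines form an
  intersection-stable generator, and on \<open>{..a}\<close> with \<open>a\<close> nonnegative both
  measures give the mean number of points up to \<open>min a T\<close>; for negative
  \<open>a\<close> both vanish.\<close>

theorem campbell:
  assumes T: "0 \<le> T" and h: "h \<in> borel_measurable borel"
  shows "(\<integral>\<^sup>+\<omega>. (\<Sum>k<A T \<omega>. h (arr_time (\<lambda>u. A u \<omega>) k)) \<partial>M) =
    (\<integral>\<^sup>+s. indicator {0..T} s * ennreal (lam s) * h s \<partial>lborel)"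
proof -
  define N where "N = distr (density (count_space UNIV \<Otimes>\<^sub>M M) (\<lambda>(k, \<omega>). indicator {..<A T \<omega>} k))
        borel (\<lambda>(k, \<omega>). trunc_arr A T k \<omega>)"
  define L where "L = density lborel (\<lambda>s. indicator {0..T} s * ennreal (lam s))"
  have N: "(\<integral>\<^sup>+s. g s \<partial>N) = (\<integral>\<^sup>+\<omega>. (\<Sum>k<A T \<omega>. g (arr_time (\<lambda>u. A u \<omega>) k)) \<partial>M)"
    if "g \<in> borel_measurable borel" for g
    unfolding N_def
    by (intro nn_integral_arr_series A_measurable path T that sigma_finite_measure_axioms)
  have L: "(\<integral>\<^sup>+s. g s \<partial>L) = (\<integral>\<^sup>+s. indicator {0..T} s * ennreal (lam s) * g s \<partial>lborel)"
    if "g \<in> borel_measurable borel" for g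
    unfolding L_def using that by (subst nn_integral_density) auto
  have sets_N: "sets N = sets borel" and sets_L: "sets L = sets borel"
    unfolding N_def L_def by simp_all
  have L_atMost: "emeasure L {..a} = (if a < 0 then 0 else ennreal (cum_rate 0 (min a T)))" for a
  proof -
    have "emeasure L {..a} = (\<integral>\<^sup>+s. indicator {0..T} s * ennreal (lam s) * indicator {..a} s \<partial>lborel)"
      using L[of "indicator {..a}"] by (simp add: sets_L)
    also have "\<dots> = (\<integral>\<^sup>+s. indicator {0..min a T} s * ennreal (lam s) \<partial>lborel)"
      by (intro nn_integral_cong) (auto simp: indicator_def)
    finally show ?thesis
      using nn_cum_rate[of "min a T"] T by (cases "a < 0") (auto simp: min_def)
  qed
  have N_atMost: "emeasure N {..a} = (if a < 0 then 0 else ennreal (cum_rate 0 (min a T)))" for a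
  proof -
    have "emeasure N {..a} = (\<integral>\<^sup>+\<omega>. (\<Sum>k<A T \<omega>. indicator {..a} (arr_time (\<lambda>u. A u \<omega>) k)) \<partial>M)"
      using N[of "indicator {..a}"] by (simp add: sets_N)
    \<comment> \<open>Subtracting \<open>A 0 \<omega>\<close>, which is 0, turns the count into an
      increment, the form in which its mean is known.\<close>
    also have "\<dots> = (\<integral>\<^sup>+\<omega>. of_nat (if a < 0 then 0 else A (min a T) \<omega> - A 0 \<omega>) \<partial>M)"
    proof (rule nn_integral_cong)
      fix \<omega> assume \<omega>: "\<omega> \<in> space M"
      note p = path[OF \<omega>]
      have "(\<Sum>k<A T \<omega>. indicator {..a} (arr_time (\<lambda>u. A u \<omega>) k) :: ennreal) =
          of_nat (card ({..<A T \<omega>} \<inter> {k. arr_time (\<lambda>u. A u \<omega>) k \<le> a}))"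
        by (simp add: indicator_def sum.If_cases)
      also have "{..<A T \<omega>} \<inter> {k. arr_time (\<lambda>u. A u \<omega>) k \<le> a} =
          (if a < 0 then {} else {..<A (min a T) \<omega>})"
        using arr_time_pos[OF p T] arr_time_le_iff[OF p T, of _ a] counting_path_mono[OF p, of a T]
          counting_path_mono[OF p T, of a]
        by (auto simp: min_def; force)
      finally show "(\<Sum>k<A T \<omega>. indicator {..a} (arr_time (\<lambda>u. A u \<omega>) k) :: ennreal) =
          of_nat (if a < 0 then 0 else A (min a T) \<omega> - A 0 \<omega>)"
        using counting_path_0[OF p] by simp
    qed
    finally show ?thesis
      using increment_mean[of 0 "min a T"] T by auto
  qed
  have "N = L"
  proof (rule measure_eqI_generator_eq[where E = "range atMost" and A = "\<lambda>i. {..real i}" and \<Omega> = UNIV])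
    show "Int_stable (range (atMost :: real \<Rightarrow> _))"
      by (auto simp: Int_stable_def)
    show "(\<Union>i. {..real i}) = UNIV"
      by (auto intro: real_arch_simple)
  qed (auto simp: N_atMost L_atMost sets_N sets_L borel_eq_atMost)
  then show ?thesis
    using N[OF h] L[OF h] by simp
qed

end

section \<open>Approximation by step functions\<close>

text \<open>The value depends only on the position relative to finitely many points, which makes closure
  under pointwise operations immediate.\<close>
definition step_on :: "real set \<Rightarrow> (real \<Rightarrow> real) \<Rightarrow> bool" where
  "step_on P G \<longleftrightarrow> finite P \<and> G \<in> borel_measurable borel \<and>
     (\<forall>x y. (\<forall>p\<in>P. x \<le> p \<longleftrightarrow> y \<le> p) \<longrightarrow> G x = G y)"

lemma step_on_eq: "step_on P G \<Longrightarrow> (\<And>p. p \<in> P \<Longrightarrow> x \<le> p \<longleftrightarrow> y \<le> p) \<Longrightarrow> G x = G y"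
  unfolding step_on_def by blast

lemma step_on_measurable: "step_on P G \<Longrightarrow> G \<in> borel_measurable borel"
  unfolding step_on_def by blast

text \<open>The union of the two point sets separates whatever either of them separates. Scaling and
  clipping reuse the lemma with the same function in both arguments.\<close>

lemma step_on_compose2:
  assumes "step_on P G" "step_on Q H" "(\<lambda>(x, y). f x y) \<in> borel_measurable (borel \<Otimes>\<^sub>M borel)"
  shows "step_on (P \<union> Q) (\<lambda>x. f (G x) (H x) :: real)"
proof -
  have [measurable]: "G \<in> borel_measurable borel" "H \<in> borel_measurable borel"
    using assms(1,2) by (auto dest: step_on_measurable)
  have "(\<lambda>x. (\<lambda>(x, y). f x y) (G x, H x)) \<in> borel_measurable borel"
    by (rule measurable_compose[OF _ assms(3)]) simp
  then show ?thesis
    using assms(1,2) unfolding step_on_def by (auto, metis Un_iff)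
qed

definition step_approximable :: "real measure \<Rightarrow> (real \<Rightarrow> real) \<Rightarrow> bool" where
  "step_approximable N G \<longleftrightarrow> (\<forall>e>0. \<exists>P H. step_on P H \<and> (\<integral>\<^sup>+x. ennreal \<bar>G x - H x\<bar> \<partial>N) < ennreal e)"

lemma step_approximableD:
  "step_approximable N G \<Longrightarrow> 0 < e \<Longrightarrow> \<exists>P H. step_on P H \<and> (\<integral>\<^sup>+x. ennreal \<bar>G x - H x\<bar> \<partial>N) < ennreal e"
  unfolding step_approximable_def by blast

lemma step_on_approximable: "step_on P H \<Longrightarrow> step_approximable N H"
  unfolding step_approximable_def by (auto intro!: exI[of _ P] exI[of _ H])

lemma nn_integral_triangle:
  fixes f g h :: "'a \<Rightarrow> real"
  assumes [measurable]: "f \<in> borel_measurable N" "g \<in> borel_measurable N" "h \<in> borel_measurable N"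
  shows "(\<integral>\<^sup>+x. ennreal \<bar>f x - h x\<bar> \<partial>N) \<le> (\<integral>\<^sup>+x. ennreal \<bar>f x - g x\<bar> \<partial>N) + (\<integral>\<^sup>+x. ennreal \<bar>g x - h x\<bar> \<partial>N)"
  by (subst nn_integral_add[symmetric])
    (auto intro!: nn_integral_mono ennreal_leI simp flip: ennreal_plus)

lemma step_approximable_add:
  assumes "step_approximable N f" "step_approximable N g"
    and sN [measurable_cong]: "sets N = sets borel"
    and [measurable]: "f \<in> borel_measurable N" "g \<in> borel_measurable N"
  shows "step_approximable N (\<lambda>x. f x + g x)"
  unfolding step_approximable_def
proof (intro allI impI)
  fix e :: real assume "e > 0"
  then have e: "e / 2 > 0" by simp
  from step_approximableD[OF assms(1) e] step_approximableD[OF assms(2) e] obtain P F Q H where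
    s: "step_on P F" "step_on Q H" and
    l: "(\<integral>\<^sup>+x. ennreal \<bar>f x - F x\<bar> \<partial>N) < ennreal (e / 2)" "(\<integral>\<^sup>+x. ennreal \<bar>g x - H x\<bar> \<partial>N) < ennreal (e / 2)"
    by blast
  note [measurable] = s[THEN step_on_measurable]
  have "(\<integral>\<^sup>+x. ennreal \<bar>(f x + g x) - (F x + H x)\<bar> \<partial>N) \<le>
      (\<integral>\<^sup>+x. ennreal \<bar>f x - F x\<bar> \<partial>N) + (\<integral>\<^sup>+x. ennreal \<bar>g x - H x\<bar> \<partial>N)"
    by (subst nn_integral_add[symmetric])
      (auto intro!: nn_integral_mono ennreal_leI simp flip: ennreal_plus)
  also have "\<dots> < ennreal (e / 2) + ennreal (e / 2)"
    by (intro add_strict_mono l)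
  also have "\<dots> = ennreal e" using e by (simp flip: ennreal_plus)
  finally have "(\<integral>\<^sup>+x. ennreal \<bar>(f x + g x) - (F x + H x)\<bar> \<partial>N) < ennreal e" .
  moreover have "step_on (P \<union> Q) (\<lambda>x. F x + H x)"
    by (rule step_on_compose2[OF s]) simp
  ultimately show "\<exists>P H. step_on P H \<and> (\<integral>\<^sup>+x. ennreal \<bar>f x + g x - H x\<bar> \<partial>N) < ennreal e"
    by blast
qed

lemma step_approximable_cmult:
  assumes "step_approximable N f"
    and sN [measurable_cong]: "sets N = sets borel"
    and [measurable]: "f \<in> borel_measurable N"
  shows "step_approximable N (\<lambda>x. c * f x)"
  unfolding step_approximable_def
proof (intro allI impI)
  fix e :: real assume "e > 0"
  then have e: "e / (\<bar>c\<bar> + 1) > 0" by simp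
  from step_approximableD[OF assms(1) e] obtain P F where
    s: "step_on P F" and l: "(\<integral>\<^sup>+x. ennreal \<bar>f x - F x\<bar> \<partial>N) < ennreal (e / (\<bar>c\<bar> + 1))"
    by blast
  note [measurable] = s[THEN step_on_measurable]
  have "(\<integral>\<^sup>+x. ennreal \<bar>c * f x - c * F x\<bar> \<partial>N) = ennreal \<bar>c\<bar> * (\<integral>\<^sup>+x. ennreal \<bar>f x - F x\<bar> \<partial>N)"
    by (subst nn_integral_cmult[symmetric])
      (auto intro!: nn_integral_cong simp: abs_mult simp flip: ennreal_mult right_diff_distrib)
  also have "\<dots> \<le> ennreal \<bar>c\<bar> * ennreal (e / (\<bar>c\<bar> + 1))"
    using l by (intro mult_left_mono) auto
  also have "\<dots> = ennreal (\<bar>c\<bar> * (e / (\<bar>c\<bar> + 1)))" using e by (simp flip: ennreal_mult)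
  also have "\<dots> < ennreal e" using \<open>e > 0\<close> by (intro ennreal_lessI) (auto simp: divide_simps)
  finally have "(\<integral>\<^sup>+x. ennreal \<bar>c * f x - c * F x\<bar> \<partial>N) < ennreal e" .
  moreover have "step_on (P \<union> P) (\<lambda>x. c * F x)"
    by (rule step_on_compose2[OF s s]) simp
  ultimately show "\<exists>P H. step_on P H \<and> (\<integral>\<^sup>+x. ennreal \<bar>c * f x - H x\<bar> \<partial>N) < ennreal e"
    by blast
qed

text \<open>Domination upgrades pointwise convergence to convergence in L1, so some
  \<open>u i\<close> is within \<open>e / 2\<close> of \<open>f\<close>, and a step function within
  another \<open>e / 2\<close> of that \<open>u i\<close>.\<close>

lemma step_approximable_lim:
  assumes "\<And>i. step_approximable N (u i)"
    and sN [measurable_cong]: "sets N = sets borel"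
    and [measurable]: "\<And>i. u i \<in> borel_measurable N" "f \<in> borel_measurable N"
    and w: "integrable N w" "\<And>i x. \<bar>u i x\<bar> \<le> w x"
    and lim: "\<And>x. (\<lambda>i. u i x) \<longlonglongrightarrow> f x"
  shows "step_approximable N f"
  unfolding step_approximable_def
proof (intro allI impI)
  fix e :: real assume "e > 0"
  then have e: "e / 2 > 0" by simp
  have w0: "0 \<le> w x" for x
    using w(2)[of undefined x] abs_ge_zero[of "u undefined x"] by linarith
  have "(\<integral>\<^sup>+x. ennreal (w x) \<partial>N) < \<infinity>"
    using w(1) w0 by (simp add: nn_integral_eq_integral)
  moreover have "w \<in> borel_measurable N" using w(1) by simp
  ultimately have "(\<lambda>i. (\<integral>\<^sup>+x. norm (f x - u i x) \<partial>N)) \<longlonglongrightarrow> 0"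
    using w(2) lim by (intro nn_integral_dominated_convergence_norm[where w = w]) auto
  then have "eventually (\<lambda>i. (\<integral>\<^sup>+x. norm (f x - u i x) \<partial>N) < ennreal (e / 2)) sequentially"
    using e by (intro order_tendstoD(2)) auto
  then obtain i where i: "(\<integral>\<^sup>+x. ennreal \<bar>f x - u i x\<bar> \<partial>N) < ennreal (e / 2)"
    by (auto simp: eventually_sequentially)
  from step_approximableD[OF assms(1) e] obtain P H where
    s: "step_on P H" and l: "(\<integral>\<^sup>+x. ennreal \<bar>u i x - H x\<bar> \<partial>N) < ennreal (e / 2)"
    by blast
  note [measurable] = s[THEN step_on_measurable]
  have "(\<integral>\<^sup>+x. ennreal \<bar>f x - H x\<bar> \<partial>N) \<le> (\<integral>\<^sup>+x. ennreal \<bar>f x - u i x\<bar> \<partial>N) + (\<integral>\<^sup>+x. ennreal \<bar>u i x - H x\<bar> \<partial>N)"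
    by (rule nn_integral_triangle) auto
  also have "\<dots> < ennreal (e / 2) + ennreal (e / 2)"
    by (intro add_strict_mono l i)
  also have "\<dots> = ennreal e" using e by (simp flip: ennreal_plus)
  finally show "\<exists>P H. step_on P H \<and> (\<integral>\<^sup>+x. ennreal \<bar>f x - H x\<bar> \<partial>N) < ennreal e"
    using s by blast
qed

text \<open>Dynkin's argument: indicators of half-lines are step functions, a complement is 1 minus
  an approximable function, and a disjoint union is a pointwise limit of finite sums. Finiteness of
  \<open>N\<close> makes the constant 1 an integrable bound for that limit.\<close>

lemma step_approximable_indicator:
  assumes "finite_measure N" and sN [measurable_cong]: "sets N = sets borel" and B: "B \<in> sets borel"
  shows "step_approximable N (indicator B)"
proof -
  interpret finite_measure N by fact
  have sets: "sets borel = sigma_sets UNIV (range (atMost :: real \<Rightarrow> _))"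
    by (simp add: borel_eq_atMost)
  have "Int_stable (range (atMost :: real \<Rightarrow> _))" by (auto simp: Int_stable_def)
  moreover have "range (atMost :: real \<Rightarrow> _) \<subseteq> Pow UNIV" by simp
  moreover have "B \<in> sigma_sets UNIV (range atMost)" using B sets by simp
  ultimately show ?thesis
  proof (induction rule: sigma_sets_induct_disjoint)
    case (basic C)
    then obtain a where "C = {..a}" by auto
    moreover have "step_on {a} (indicator {..a} :: real \<Rightarrow> real)"
      by (auto simp: step_on_def indicator_def)
    ultimately show ?case by (auto intro: step_on_approximable)
  next
    case empty
    have "step_on {} (indicator {} :: real \<Rightarrow> real)" by (auto simp: step_on_def)
    then show ?case by (rule step_on_approximable)
  next
    case (compl C)
    then have C [measurable]: "C \<in> sets borel" using sets by simp
    have "step_on {} (\<lambda>x. 1)" by (auto simp: step_on_def)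
    then have "step_approximable N (\<lambda>x. 1 + (- 1) * indicator C x)"
      by (intro step_approximable_add step_approximable_cmult compl.IH)
        (auto intro: step_on_approximable simp: sN)
    also have "(\<lambda>x. 1 + (- 1) * indicator C x) = (indicator (UNIV - C) :: real \<Rightarrow> real)"
      by (auto simp: indicator_def)
    finally show ?case .
  next
    case (union C)
    then have C [measurable]: "C i \<in> sets borel" for i using sets by auto
    have *: "step_approximable N (\<lambda>x. \<Sum>i<n. indicator (C i) x)" for n :: nat
    proof (induction n)
      case 0
      have "step_on {} (\<lambda>x. 0)" by (auto simp: step_on_def)
      then show ?case by (auto intro: step_on_approximable)
    next
      case (Suc n)
      show ?case
        using step_approximable_add[OF Suc union.IH[of n] sN] by simp
    qed
    have eq: "(\<Sum>i<n. indicator (C i) x) = (indicator (\<Union>i<n. C i) x :: real)" for n x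
      using union.hyps(1) by (subst indicator_UN_disjoint) (auto simp: disjoint_family_on_def)
    show ?case
    proof (rule step_approximable_lim[where w = "\<lambda>_. 1", OF * sN])
      show "(\<lambda>n. \<Sum>i<n. indicator (C i) x) \<longlonglongrightarrow> (indicator (\<Union> (range C)) x :: real)" for x
        unfolding eq by (rule LIMSEQ_indicator_UN)
      show "\<bar>\<Sum>i<n. indicator (C i) x\<bar> \<le> (1 :: real)" for n x
        unfolding eq by (simp add: indicator_def)
    qed auto
  qed
qed

lemma integrable_step_approximable:
  assumes "finite_measure N" and sN [measurable_cong]: "sets N = sets borel"
    and "integrable N G"
  shows "step_approximable N G"
  using assms(3)
proof (induction rule: integrable_induct)
  case (base B c)
  then show ?case
    using step_approximable_cmult[OF step_approximable_indicator[OF assms(1,2), of B], of c] sN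
    by (simp add: mult.commute)
next
  case (add f g)
  show ?case
    by (rule step_approximable_add[OF add.IH sN]) (rule borel_measurable_integrable[OF add.hyps(1)] borel_measurable_integrable[OF add.hyps(2)])+
next
  case (lim f u)
  have sp: "space N = UNIV" using sets_eq_imp_space_eq[OF sN] by simp
  show ?case
  proof (rule step_approximable_lim[where w = "\<lambda>x. 2 * norm (f x)" and u = u, OF lim.IH sN])
    show "u i \<in> borel_measurable N" for i using lim.hyps(1) by blast
    show "f \<in> borel_measurable N" "integrable N (\<lambda>x. 2 * norm (f x))"
      using lim.hyps(4) by auto
    show "\<bar>u i x\<bar> \<le> 2 * norm (f x)" "(\<lambda>i. u i x) \<longlonglongrightarrow> f x" for i x
      using lim.hyps(2,3)[of x] by (auto simp: sp)
  qed
qed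

text \<open>Clipping to \<open>[0,1]\<close> moves no value away from the values of
  \<open>G\<close>, so the L1 error does not grow. The range matters later: products of factors in
  \<open>[0,1]\<close> differ by at most the sum of the differences of the factors.\<close>

lemma ex_step_unit_interval_approx:
  assumes "finite_measure N" and sN [measurable_cong]: "sets N = sets borel"
    and [measurable]: "G \<in> borel_measurable borel" and G: "\<And>x. 0 \<le> G x \<and> G x \<le> 1" and e: "0 < e"
  obtains P H where "step_on P H" "\<And>x. 0 \<le> H x \<and> H x \<le> 1"
    "(\<integral>\<^sup>+x. ennreal \<bar>G x - H x\<bar> \<partial>N) < ennreal e"
proof -
  interpret finite_measure N by fact
  have "integrable N G"
    by (rule integrable_const_bound[of _ 1]) (use G in auto)
  from step_approximableD[OF integrable_step_approximable[OF assms(1,2) this] e]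
  obtain P H where H: "step_on P H" "(\<integral>\<^sup>+x. ennreal \<bar>G x - H x\<bar> \<partial>N) < ennreal e" by blast
  have "step_on (P \<union> P) (\<lambda>x. max 0 (min 1 (H x)))"
    by (rule step_on_compose2[OF H(1) H(1)]) simp
  moreover have "\<bar>G x - max 0 (min 1 (H x))\<bar> \<le> \<bar>G x - H x\<bar>" for x
    using G[of x] by (auto simp: max_def min_def)
  then have "(\<integral>\<^sup>+x. ennreal \<bar>G x - max 0 (min 1 (H x))\<bar> \<partial>N) \<le> (\<integral>\<^sup>+x. ennreal \<bar>G x - H x\<bar> \<partial>N)"
    by (intro nn_integral_mono ennreal_leI)
  with H(2) have "(\<integral>\<^sup>+x. ennreal \<bar>G x - max 0 (min 1 (H x))\<bar> \<partial>N) < ennreal e" by simp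
  moreover have "0 \<le> max 0 (min 1 (H x)) \<and> max 0 (min 1 (H x)) \<le> 1" for x
    by simp
  ultimately show ?thesis by (intro that)
qed

text \<open>The points of \<open>P\<close> inside \<open>[0,T]\<close> and both ends, sorted. Points
  of \<open>P\<close> may be cell ends but not interior points; since \<open>step_on\<close> tests
  \<open>x \<le> p\<close>, a step function is then constant on each cell
  \<open>{s i<..s (Suc i)}\<close>.\<close>

lemma ex_grid:
  assumes "finite P" "0 < T"
  obtains r :: nat and s :: "nat \<Rightarrow> real" where "s 0 = 0" "s r = T"
    "\<And>i. i < r \<Longrightarrow> s i < s (Suc i)"
    "\<And>i p. i < r \<Longrightarrow> p \<in> P \<Longrightarrow> \<not> (s i < p \<and> p < s (Suc i))"
proof -
  define X where "X = insert 0 (insert T (P \<inter> {0..T}))"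
  define xs where "xs = sorted_list_of_set X"
  have [simp]: "finite X" using assms by (simp add: X_def)
  have set: "set xs = X" and srt: "sorted_wrt (<) xs"
    by (simp_all add: xs_def)
  have less: "xs ! i < xs ! j" if "i < j" "j < length xs" for i j
    using srt that by (simp add: sorted_wrt_iff_nth_less)
  have mono: "i < j" if "xs ! i < xs ! j" "i < length xs" for i j
    using less[of j i] that by (cases i j rule: linorder_cases) auto
  have "0 \<in> set xs" by (simp add: set X_def)
  then obtain i0 where i0: "i0 < length xs" "xs ! i0 = 0"
    unfolding in_set_conv_nth by blast
  have "T \<in> set xs" by (simp add: set X_def)
  then obtain i1 where i1: "i1 < length xs" "xs ! i1 = T"
    unfolding in_set_conv_nth by blast
  have bnd: "0 \<le> xs ! i \<and> xs ! i \<le> T" if "i < length xs" for i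
    using nth_mem[OF that] assms(2) by (auto simp: set X_def)
  have "0 < length xs" using i0(1) by linarith
  have "i0 = 0"
  proof (rule ccontr)
    assume "i0 \<noteq> 0"
    then have "xs ! 0 < xs ! i0" using i0(1) by (intro less) auto
    with bnd[OF \<open>0 < length xs\<close>] i0(2) show False by linarith
  qed
  show ?thesis
  proof (rule that[of "\<lambda>i. xs ! i" i1])
    fix i p assume i: "i < i1" and p: "p \<in> P"
    show "\<not> (xs ! i < p \<and> p < xs ! Suc i)"
    proof
      \<comment> \<open>Such a \<open>p\<close> would be a sorted entry whose index lies strictly
        between \<open>i\<close> and \<open>Suc i\<close>.\<close>
      assume *: "xs ! i < p \<and> p < xs ! Suc i"
      have il: "i < length xs" "Suc i < length xs" using i i1(1) by auto
      from * bnd[OF il(1)] bnd[OF il(2)] p have "p \<in> X" by (simp add: X_def)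
      then have "p \<in> set xs" by (simp add: set)
      then obtain j where j: "j < length xs" "p = xs ! j"
        unfolding in_set_conv_nth by blast
      have "i < j" using * j(2) by (intro mono[OF _ il(1)]) simp
      moreover have "j < Suc i" using * j(2) by (intro mono[OF _ j(1)]) simp
      ultimately show False by simp
    qed
  next
    show "xs ! 0 = 0" using i0(2) \<open>i0 = 0\<close> by simp
    show "xs ! i1 = T" by (rule i1(2))
    show "xs ! i < xs ! Suc i" if "i < i1" for i
      using that i1(1) by (intro less) auto
  qed
qed

section \<open>The Poisson functional\<close>

text \<open>The slope of \<open>exp (- x)\<close> has size at most 1 on nonnegative arguments. This
  carries closeness of the exponents over to the right-hand side of the Poisson functional.\<close>

lemma abs_exp_minus_diff_le:
  fixes a b :: real
  assumes "0 \<le> a" "0 \<le> b"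
  shows "\<bar>exp (- a) - exp (- b)\<bar> \<le> \<bar>a - b\<bar>"
proof -
  have *: "exp (- a) - exp (- b) \<le> b - a" if "a \<le> b" "0 \<le> a" for a b :: real
  proof -
    have "exp (- a) - exp (- b) = exp (- a) * (1 - exp (- (b - a)))"
      by (simp add: algebra_simps flip: exp_add)
    also have "\<dots> \<le> 1 * (b - a)"
    proof (intro mult_mono)
      show "1 - exp (- (b - a)) \<le> b - a" using exp_ge_add_one_self[of "- (b - a)"] by linarith
    qed (use that in auto)
    finally show ?thesis by simp
  qed
  show ?thesis using *[of a b] *[of b a] assms by (cases "a \<le> b") auto
qed

context poisson_stream
begin

definition arrival_product :: "real \<Rightarrow> (real \<Rightarrow> real) \<Rightarrow> 'a \<Rightarrow> real" where
  "arrival_product T G \<omega> = (\<Prod>k<A T \<omega>. G (arr_time (\<lambda>u. A u \<omega>) k))"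

lemma arrival_product_measurable [measurable]:
  assumes "0 \<le> T" and [measurable]: "G \<in> borel_measurable borel"
  shows "arrival_product T G \<in> borel_measurable M"
proof -
  have [measurable]: "trunc_arr A T k \<in> borel_measurable M" for k using assms(1) by simp
  \<comment> \<open>The number of factors is random, so the product is split over the countably many
    values of \<open>A T\<close>; for indices below \<open>A T \<omega>\<close>,
    \<open>trunc_arr\<close> and \<open>arr_time\<close> agree.\<close>
  have "(\<lambda>\<omega>. \<Prod>k<A T \<omega>. G (trunc_arr A T k \<omega>)) \<in> borel_measurable M"
    by (rule measurable_compose_countable[OF _ A_measurable]) simp
  also have "(\<lambda>\<omega>. \<Prod>k<A T \<omega>. G (trunc_arr A T k \<omega>)) = arrival_product T G"
    by (auto simp: arrival_product_def trunc_arr_def fun_eq_iff intro!: prod.cong)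
  finally show ?thesis .
qed

lemma arrival_product_bounds:
  assumes "\<And>x. 0 \<le> G x \<and> G x \<le> 1"
  shows "0 \<le> arrival_product T G \<omega>" "arrival_product T G \<omega> \<le> 1"
  unfolding arrival_product_def using assms by (auto intro!: prod_nonneg prod_le_1)

text \<open>The indices from \<open>A (s j) \<omega>\<close> up to but excluding
  \<open>A (s (Suc j)) \<omega>\<close> belong to the arrivals in cell \<open>j\<close>, and each
  contributes the same factor. The product thus becomes a function of the increments alone, which is
  what independence can handle.\<close>

lemma arrival_product_grid:
  assumes \<omega>: "\<omega> \<in> space M"
    and s: "s 0 = 0" "\<And>i. i < r \<Longrightarrow> s i < s (Suc i)"
    and G: "\<And>i x. i < r \<Longrightarrow> s i < x \<Longrightarrow> x \<le> s (Suc i) \<Longrightarrow> G x = G (s (Suc i))"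
    and "i \<le> r"
  shows "0 \<le> s i \<and> arrival_product (s i) G \<omega> = (\<Prod>j<i. G (s (Suc j)) ^ (A (s (Suc j)) \<omega> - A (s j) \<omega>))"
  using \<open>i \<le> r\<close>
proof (induction i)
  case 0
  show ?case using s(1) counting_path_0[OF path[OF \<omega>]] by (simp add: arrival_product_def)
next
  case (Suc i)
  note p = path[OF \<omega>]
  let ?a = "arr_time (\<lambda>u. A u \<omega>)"
  have i: "i < r" using Suc.prems by simp
  have si: "0 \<le> s i" using Suc.IH i by simp
  have lt: "s i < s (Suc i)" by (rule s(2)[OF i])
  have mono: "A (s i) \<omega> \<le> A (s (Suc i)) \<omega>" using counting_path_mono[OF p si] lt by simp
  have "arrival_product (s (Suc i)) G \<omega> =
      (\<Prod>k<A (s i) \<omega>. G (?a k)) * (\<Prod>k\<in>{A (s i) \<omega>..<A (s (Suc i)) \<omega>}. G (?a k))"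
    unfolding arrival_product_def lessThan_atLeast0 using mono
    by (simp add: prod.atLeastLessThan_concat)
  also have "(\<Prod>k\<in>{A (s i) \<omega>..<A (s (Suc i)) \<omega>}. G (?a k)) =
      (\<Prod>k\<in>{A (s i) \<omega>..<A (s (Suc i)) \<omega>}. G (s (Suc i)))"
  proof (rule prod.cong[OF refl])
    fix k assume k: "k \<in> {A (s i) \<omega>..<A (s (Suc i)) \<omega>}"
    have T: "0 \<le> s (Suc i)" using si lt by simp
    have "?a k \<le> s (Suc i)" using k by (intro arr_time_le[OF p T]) simp
    moreover have "s i < ?a k" using arr_time_le_iff[OF p T, of k "s i"] k si by simp
    ultimately show "G (?a k) = G (s (Suc i))" by (intro G[OF i])
  qed
  also have "\<dots> = G (s (Suc i)) ^ (A (s (Suc i)) \<omega> - A (s i) \<omega>)"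
    by simp
  also have "(\<Prod>k<A (s i) \<omega>. G (?a k)) = (\<Prod>j<i. G (s (Suc j)) ^ (A (s (Suc j)) \<omega> - A (s j) \<omega>))"
    using Suc.IH i by (simp add: arrival_product_def)
  finally have "arrival_product (s (Suc i)) G \<omega> =
      (\<Prod>j<Suc i. G (s (Suc j)) ^ (A (s (Suc j)) \<omega> - A (s j) \<omega>))"
    by (simp only: prod.lessThan_Suc)
  moreover have "0 \<le> s (Suc i)" using si lt by simp
  ultimately show ?case by blast
qed

lemma set_integral_grid:
  assumes s: "s 0 = 0" "\<And>i. i < r \<Longrightarrow> s i < s (Suc i)"
    and [measurable]: "G \<in> borel_measurable borel" and G01: "\<And>x. 0 \<le> G x \<and> G x \<le> 1"
    and G: "\<And>i x. i < r \<Longrightarrow> s i < x \<Longrightarrow> x \<le> s (Suc i) \<Longrightarrow> G x = G (s (Suc i))"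
    and "i \<le> r"
  shows "0 \<le> s i \<and> (LINT x:{0..s i}|lborel. (1 - G x) * lam x) =
    (\<Sum>j<i. (1 - G (s (Suc j))) * cum_rate (s j) (s (Suc j)))"
  using \<open>i \<le> r\<close>
proof (induction i)
  case 0
  have "{0..0::real} = {0}" by auto
  moreover have "(LINT x:{0}|lborel. (1 - G x) * lam x) = 0"
    unfolding set_lebesgue_integral_def
    by (rule integral_eq_zero_AE) (rule AE_mp[OF AE_lborel_singleton[of 0]], auto)
  ultimately show ?case using s(1) by simp
next
  case (Suc i)
  have i: "i < r" using Suc.prems by simp
  have si: "0 \<le> s i" using Suc.IH i by simp
  have lt: "s i < s (Suc i)" by (rule s(2)[OF i])
  have int: "set_integrable lborel {0..b} (\<lambda>x. (1 - G x) * lam x)" if "0 \<le> b" for b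
    using lam_loc_int[OF that] unfolding set_integrable_def
  proof (rule Bochner_Integration.integrable_bound)
    show "AE x in lborel. norm (indicator {0..b} x *\<^sub>R ((1 - G x) * lam x)) \<le> norm (indicator {0..b} x *\<^sub>R lam x)"
      using G01 by (intro AE_I2) (auto simp: indicator_def abs_mult intro!: mult_left_le_one_le)
  qed simp
  have un: "{0..s (Suc i)} = {0..s i} \<union> {s i<..s (Suc i)}" using si lt by auto
  have sub: "set_integrable lborel {s i<..s (Suc i)} (\<lambda>x. (1 - G x) * lam x)"
    by (rule set_integrable_subset[OF int[of "s (Suc i)"]]) (use si lt in auto)
  have "(LINT x:{0..s (Suc i)}|lborel. (1 - G x) * lam x) =
      (LINT x:{0..s i}|lborel. (1 - G x) * lam x) + (LINT x:{s i<..s (Suc i)}|lborel. (1 - G x) * lam x)"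
    unfolding un by (rule set_integral_Un[OF _ int[OF si] sub]) auto
  also have "(LINT x:{s i<..s (Suc i)}|lborel. (1 - G x) * lam x) =
      (LINT x:{s i<..s (Suc i)}|lborel. (1 - G (s (Suc i))) * lam x)"
    by (rule set_lebesgue_integral_cong) (auto dest: G[OF i])
  also have "\<dots> = (1 - G (s (Suc i))) * (LINT x:{s i<..s (Suc i)}|lborel. lam x)"
    by simp
  also have "(LINT x:{s i<..s (Suc i)}|lborel. lam x) = cum_rate (s i) (s (Suc i))"
    unfolding set_lebesgue_integral_def
  \<comment> \<open>The cell omits its left end while \<open>cum_rate\<close> includes it; the
    difference is a null set.\<close>
  proof (rule integral_cong_AE)
    show "AE x in lborel. indicator {s i<..s (Suc i)} x *\<^sub>R lam x = indicator {s i..s (Suc i)} x *\<^sub>R lam x"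
      by (rule AE_mp[OF AE_lborel_singleton[of "s i"]]) (auto simp: indicator_def)
  qed simp_all
  finally show ?case using Suc.IH i si lt by simp
qed

text \<open>On a grid adapted to \<open>G\<close> the product consists of powers of independent
  Poisson increments. Each expectation is a probability generating function at the value of
  \<open>G\<close> on the cell, and the exponents add up to the integral.\<close>

lemma arrival_product_step:
  assumes T: "0 < T" and P: "step_on P G" and G01: "\<And>x. 0 \<le> G x \<and> G x \<le> 1"
  shows "expectation (arrival_product T G) = exp (- (LINT s:{0..T}|lborel. (1 - G s) * lam s))"
proof -
  have [measurable]: "G \<in> borel_measurable borel" by (rule step_on_measurable[OF P])
  from P have "finite P" by (simp add: step_on_def)
  from ex_grid[OF this T] obtain r s where s0: "s 0 = 0" and sr: "s r = T"
    and inc: "\<And>i. i < r \<Longrightarrow> s i < s (Suc i)"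
    and gr: "\<And>i p. i < r \<Longrightarrow> p \<in> P \<Longrightarrow> \<not> (s i < p \<and> p < s (Suc i))" by blast
  have Gc: "G x = G (s (Suc i))" if "i < r" "s i < x" "x \<le> s (Suc i)" for i x
  proof (rule step_on_eq[OF P])
    fix p assume "p \<in> P"
    from gr[OF that(1) this] that(2,3) show "x \<le> p \<longleftrightarrow> s (Suc i) \<le> p" by auto
  qed
  have sig: "0 \<le> s i \<and> (LINT x:{0..s i}|lborel. (1 - G x) * lam x) =
      (\<Sum>j<i. (1 - G (s (Suc j))) * cum_rate (s j) (s (Suc j)))" if "i \<le> r" for i
    by (rule set_integral_grid[where s = s and r = r and G = G, OF s0 inc _ G01 Gc that]) simp_all
  define X where "X i \<omega> = G (s (Suc i)) ^ (A (s (Suc i)) \<omega> - A (s i) \<omega>)" for i \<omega>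
  have ind: "indep_vars (\<lambda>_. count_space UNIV) (\<lambda>i \<omega>. A (s (Suc i)) \<omega> - A (s i) \<omega>) {..<r}"
  proof -
    have "\<forall>(r::nat) (s::nat \<Rightarrow> real). 0 \<le> s 0 \<longrightarrow> (\<forall>i<r. s i < s (Suc i)) \<longrightarrow>
        indep_vars (\<lambda>_. count_space UNIV) (\<lambda>i \<omega>. A (s (Suc i)) \<omega> - A (s i) \<omega>) {..<r}"
      using poisson unfolding poisson_process_def by blast
    note * = this[THEN spec[of _ r], THEN spec[of _ s], THEN mp, THEN mp]
    show ?thesis by (rule *) (simp add: s0, intro allI impI inc)
  qed
  have "indep_vars (\<lambda>_. borel) (\<lambda>i. (\<lambda>j. G (s (Suc i)) ^ j) \<circ> (\<lambda>\<omega>. A (s (Suc i)) \<omega> - A (s i) \<omega>)) {..<r}"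
    by (rule indep_vars_compose[OF ind]) simp
  then have indX: "indep_vars (\<lambda>_. borel) X {..<r}"
    by (simp add: X_def[abs_def] comp_def)
  have [measurable]: "X i \<in> borel_measurable M" for i unfolding X_def by measurable
  have X01: "0 \<le> X i \<omega>" "X i \<omega> \<le> 1" for i \<omega>
    unfolding X_def using G01 by (auto intro: power_le_one)
  have intX: "integrable M (X i)" for i
    by (rule integrable_const_bound[of _ 1]) (use X01 in auto)
  have snn: "0 \<le> s i" if "i \<le> r" for i
    using sig[OF that] by blast
  have EX: "expectation (X i) = exp (- ((1 - G (s (Suc i))) * cum_rate (s i) (s (Suc i))))" if "i < r" for i
  proof -
    have "ennreal (expectation (X i)) = (\<integral>\<^sup>+\<omega>. ennreal (X i \<omega>) \<partial>M)"
      by (rule nn_integral_eq_integral[symmetric, OF intX]) (use X01 in auto)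
    also have "\<dots> = ennreal (exp (- (1 - G (s (Suc i))) * cum_rate (s i) (s (Suc i))))"
      unfolding X_def using snn[of i] inc[OF that] that G01 by (intro increment_pgf) simp_all
    finally show ?thesis
      by (subst (asm) ennreal_inj) (simp_all add: X01 algebra_simps)
  qed
  have "expectation (arrival_product T G) = expectation (\<lambda>\<omega>. \<Prod>i<r. X i \<omega>)"
  proof (rule Bochner_Integration.integral_cong[OF refl])
    fix \<omega> assume \<omega>: "\<omega> \<in> space M"
    have "arrival_product (s r) G \<omega> = (\<Prod>j<r. X j \<omega>)"
      unfolding X_def
      by (rule conjunct2[OF arrival_product_grid[where r = r and s = s and G = G, OF \<omega> s0 inc Gc order_refl]])
    then show "arrival_product T G \<omega> = (\<Prod>j<r. X j \<omega>)" by (simp only: sr)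
  qed
  also have "\<dots> = (\<Prod>i<r. expectation (X i))"
    by (rule indep_vars_lebesgue_integral[OF _ indX intX]) simp
  also have "\<dots> = exp (- (\<Sum>i<r. (1 - G (s (Suc i))) * cum_rate (s i) (s (Suc i))))"
    by (simp only: sum_negf[symmetric] exp_sum[OF finite_lessThan]) (rule prod.cong[OF refl], simp add: EX)
  also have "(\<Sum>i<r. (1 - G (s (Suc i))) * cum_rate (s i) (s (Suc i))) = (LINT s:{0..T}|lborel. (1 - G s) * lam s)"
    using sig[of r] by (simp add: sr)
  finally show ?thesis .
qed

lemma set_integrable_lam_mult:
  assumes "0 \<le> T" and [measurable]: "G \<in> borel_measurable borel" and G: "\<And>x. \<bar>G x\<bar> \<le> 1"
  shows "set_integrable lborel {0..T} (\<lambda>x. G x * lam x)"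
  using lam_loc_int[OF assms(1)] unfolding set_integrable_def
proof (rule Bochner_Integration.integrable_bound)
  show "AE x in lborel. norm (indicator {0..T} x *\<^sub>R (G x * lam x)) \<le> norm (indicator {0..T} x *\<^sub>R lam x)"
    using G by (intro AE_I2) (auto simp: indicator_def abs_mult intro!: mult_left_le_one_le)
qed simp

text \<open>Replacing \<open>G\<close> by a step function \<open>H\<close> costs on both sides at
  most the L1 distance under the rate measure \<open>N\<close>: on the left by the product
  inequality and Campbell's formula, on the right because the exponents differ by at most that
  distance and \<open>exp (- x)\<close> is Lipschitz. Each side gets \<open>e / 2\<close>.\<close>

theorem poisson_functional:
  assumes T: "0 < T" and [measurable]: "G \<in> borel_measurable borel" and G01: "\<And>x. 0 \<le> G x \<and> G x \<le> 1"
  shows "expectation (arrival_product T G) = exp (- (LINT s:{0..T}|lborel. (1 - G s) * lam s))"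
proof -
  define I where "I H = (LINT s:{0..T}|lborel. (1 - H s) * lam s)" for H
  define N where "N = density lborel (\<lambda>s. indicator {0..T} s * ennreal (lam s))"
  have sN: "sets N = sets borel" by (simp add: N_def)
  have "emeasure N (space N) = ennreal (cum_rate 0 T)"
    unfolding N_def using T by (subst emeasure_density) (auto simp: nn_cum_rate)
  then have N: "finite_measure N" by (intro finite_measureI) simp
  \<comment> \<open>The form \<open>0 + e\<close> is the one that \<open>field_le_epsilon\<close>
    expects.\<close>
  have "\<bar>expectation (arrival_product T G) - exp (- I G)\<bar> \<le> 0 + e" if e: "e > 0" for e
  proof -
    from e have e2: "e / 2 > 0" by simp
    from ex_step_unit_interval_approx[OF N sN assms(2) G01 e2] obtain P H where
      P: "step_on P H" and H01: "\<And>x. 0 \<le> H x \<and> H x \<le> 1"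
      and lt: "(\<integral>\<^sup>+x. ennreal \<bar>G x - H x\<bar> \<partial>N) < ennreal (e / 2)" by blast
    have [measurable]: "H \<in> borel_measurable borel" by (rule step_on_measurable[OF P])
    have diff01: "\<bar>G x - H x\<bar> \<le> 1" for x using G01[of x] H01[of x] by auto
    have nn: "(\<integral>\<^sup>+x. ennreal \<bar>G x - H x\<bar> \<partial>N) =
        (\<integral>\<^sup>+s. indicator {0..T} s * ennreal (lam s) * ennreal \<bar>G s - H s\<bar> \<partial>lborel)"
      unfolding N_def by (subst nn_integral_density) auto
    have int: "integrable M (arrival_product T F)" if "F \<in> borel_measurable borel" "\<And>x. 0 \<le> F x \<and> F x \<le> 1" for F
      using T that arrival_product_bounds[of F T]
      by (intro integrable_const_bound[of _ 1]) auto
    have "ennreal \<bar>expectation (arrival_product T G) - expectation (arrival_product T H)\<bar> \<le>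
        ennreal (expectation (\<lambda>\<omega>. \<bar>arrival_product T G \<omega> - arrival_product T H \<omega>\<bar>))"
      using integral_abs_bound[of M "\<lambda>\<omega>. arrival_product T G \<omega> - arrival_product T H \<omega>"] G01 H01
      by (intro ennreal_leI) (simp add: Bochner_Integration.integral_diff int)
    also have "\<dots> = (\<integral>\<^sup>+\<omega>. ennreal \<bar>arrival_product T G \<omega> - arrival_product T H \<omega>\<bar> \<partial>M)"
      using G01 H01 by (intro nn_integral_eq_integral[symmetric]) (auto intro!: Bochner_Integration.integrable_abs Bochner_Integration.integrable_diff int)
    also have "\<dots> \<le> (\<integral>\<^sup>+\<omega>. (\<Sum>k<A T \<omega>. ennreal \<bar>G (arr_time (\<lambda>u. A u \<omega>) k) - H (arr_time (\<lambda>u. A u \<omega>) k)\<bar>) \<partial>M)"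
    proof (rule nn_integral_mono)
      fix \<omega>
      let ?a = "arr_time (\<lambda>u. A u \<omega>)"
      \<comment> \<open>Telescoping: for factors in the unit ball a product changes by at most the
        sum of the changes of its factors.\<close>
      have "\<bar>arrival_product T G \<omega> - arrival_product T H \<omega>\<bar> \<le> (\<Sum>k<A T \<omega>. \<bar>G (?a k) - H (?a k)\<bar>)"
        unfolding arrival_product_def
        using norm_prod_diff[of "{..<A T \<omega>}" "\<lambda>k. G (?a k)" "\<lambda>k. H (?a k)"] G01 H01 by auto
      then show "ennreal \<bar>arrival_product T G \<omega> - arrival_product T H \<omega>\<bar> \<le> (\<Sum>k<A T \<omega>. ennreal \<bar>G (?a k) - H (?a k)\<bar>)"
        by (subst sum_ennreal) (auto intro: ennreal_leI)
    qed
    also have "\<dots> = (\<integral>\<^sup>+x. ennreal \<bar>G x - H x\<bar> \<partial>N)"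
      unfolding nn using T by (intro campbell) auto
    also note lt
    finally have 1: "\<bar>expectation (arrival_product T G) - expectation (arrival_product T H)\<bar> < e / 2"
      by (simp add: ennreal_less_iff)
    have set_int: "set_integrable lborel {0..T} (\<lambda>x. (1 - F x) * lam x)"
      if "F \<in> borel_measurable borel" "\<And>x. 0 \<le> F x \<and> F x \<le> 1" for F
      using T that by (intro set_integrable_lam_mult) auto
    have Inn: "0 \<le> I F" if "\<And>x. 0 \<le> F x \<and> F x \<le> 1" for F
      unfolding I_def set_lebesgue_integral_def using that
      by (intro integral_nonneg_AE AE_I2) (auto simp: indicator_def lam_nonneg)
    have "I H - I G = (LINT s:{0..T}|lborel. (G s - H s) * lam s)"
    proof -
      have "I H - I G = (LINT s:{0..T}|lborel. (1 - H s) * lam s - (1 - G s) * lam s)"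
        unfolding I_def by (rule set_integral_diff(2)[symmetric]) (auto intro!: set_int G01 H01)
      then show ?thesis by (simp add: algebra_simps)
    qed
    moreover have "\<bar>indicator {0..T} s *\<^sub>R ((G s - H s) * lam s)\<bar> =
        indicator {0..T} s *\<^sub>R (\<bar>G s - H s\<bar> * lam s)" for s
      by (auto simp: indicator_def abs_mult lam_nonneg)
    ultimately have "\<bar>I H - I G\<bar> \<le> (LINT s:{0..T}|lborel. \<bar>G s - H s\<bar> * lam s)"
      unfolding set_lebesgue_integral_def
      using integral_abs_bound[of lborel "\<lambda>s. indicator {0..T} s *\<^sub>R ((G s - H s) * lam s)"]
      by simp
    then have "ennreal \<bar>I H - I G\<bar> \<le> ennreal (LINT s:{0..T}|lborel. \<bar>G s - H s\<bar> * lam s)"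
      by (rule ennreal_leI)
    also have "\<dots> = (\<integral>\<^sup>+s. ennreal (indicator {0..T} s *\<^sub>R (\<bar>G s - H s\<bar> * lam s)) \<partial>lborel)"
      unfolding set_lebesgue_integral_def
      using set_integrable_lam_mult[of T "\<lambda>s. \<bar>G s - H s\<bar>"] diff01 T unfolding set_integrable_def
      by (intro nn_integral_eq_integral[symmetric]) (auto simp: indicator_def lam_nonneg)
    also have "\<dots> = (\<integral>\<^sup>+x. ennreal \<bar>G x - H x\<bar> \<partial>N)"
      unfolding nn by (intro nn_integral_cong) (auto simp: indicator_def ennreal_mult lam_nonneg mult.commute)
    also note lt
    finally have 2: "\<bar>I H - I G\<bar> < e / 2" by (simp add: ennreal_less_iff)
    have "\<bar>exp (- I H) - exp (- I G)\<bar> \<le> \<bar>I H - I G\<bar>"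
      using Inn[of H] Inn[of G] G01 H01 by (intro abs_exp_minus_diff_le) auto
    moreover have "expectation (arrival_product T H) = exp (- I H)"
      unfolding I_def by (rule arrival_product_step[OF T P H01])
    ultimately show ?thesis using 1 2 by linarith
  qed
  then have "\<bar>expectation (arrival_product T G) - exp (- I G)\<bar> \<le> 0"
    by (rule field_le_epsilon)
  then show ?thesis by (simp add: I_def)
qed

end

section \<open>Kernels\<close>

text \<open>Finite-dimensional cylinders generate the product sigma-algebra and are stable under
  intersection; on them the product measure is a finite product of kernel values, each measurable in
  the parameter.\<close>

lemma measurable_PiM_kernel:
  assumes K: "K \<in> M \<rightarrow>\<^sub>M prob_algebra N"
  shows "(\<lambda>x. Pi\<^sub>M I (\<lambda>_. K x)) \<in> M \<rightarrow>\<^sub>M prob_algebra (Pi\<^sub>M I (\<lambda>_. N))"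
proof (rule measurable_prob_algebra_generated[OF sets_PiM Int_stable_prod_algebra prod_algebra_sets_into_space])
  have Ka: "prob_space (K a)" "sets (K a) = sets N" if "a \<in> space M" for a
    using measurable_space[OF K that] by (auto simp: space_prob_algebra)
  fix a assume a: "a \<in> space M"
  show "prob_space (Pi\<^sub>M I (\<lambda>_. K a))" by (rule prob_space_PiM) (rule Ka[OF a])
  show "sets (Pi\<^sub>M I (\<lambda>_. K a)) = sets (Pi\<^sub>M I (\<lambda>_. N))"
    by (rule sets_PiM_cong) (simp_all add: Ka[OF a])
next
  have Ka: "prob_space (K a)" "sets (K a) = sets N" if "a \<in> space M" for a
    using measurable_space[OF K that] by (auto simp: space_prob_algebra)
  fix B assume "B \<in> prod_algebra I (\<lambda>_. N)"
  then obtain J E where B: "B = prod_emb I (\<lambda>_. N) J (Pi\<^sub>E J E)" and J: "finite J" "J \<subseteq> I"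
    and E: "\<And>i. i \<in> J \<Longrightarrow> E i \<in> sets N"
    by (rule prod_algebraE) (rule that)
  have eq: "emeasure (Pi\<^sub>M I (\<lambda>_. K a)) B = (\<Prod>i\<in>J. emeasure (K a) (E i))" if a: "a \<in> space M" for a
  proof -
    have "B = prod_emb I (\<lambda>_. K a) J (Pi\<^sub>E J E)"
      unfolding B prod_emb_def using sets_eq_imp_space_eq[OF Ka(2)[OF a]] by simp
    then show ?thesis
      using J E Ka[OF a] by (simp add: emeasure_PiM_emb)
  qed
  have "(\<lambda>a. \<Prod>i\<in>J. emeasure (K a) (E i)) \<in> borel_measurable M"
    by (intro borel_measurable_prod_ennreal
      measurable_emeasure_kernel[OF measurable_prob_algebraD[OF K]] E)
  then show "(\<lambda>a. emeasure (Pi\<^sub>M I (\<lambda>_. K a)) B) \<in> borel_measurable M"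
    by (subst measurable_cong[OF eq])
qed

text \<open>Extends a conditional law from rectangles to joint functions of \<open>X\<close> and
  \<open>Y\<close>. The two weights differ because in the application they hold the other batches,
  before and after their marks are integrated out. Both sides are integrals of \<open>h\<close>,
  against \<open>P\<close> (the pair under weight \<open>w\<close>) and \<open>Q\<close>
  (\<open>X\<close> under weight \<open>v\<close>, followed by \<open>K\<close>); \<open>fin\<close>
  gives the finiteness required for uniqueness from rectangles.\<close>

lemma nn_integral_kernel_replace:
  fixes w v :: "'a \<Rightarrow> ennreal"
  assumes K: "K \<in> S \<rightarrow>\<^sub>M prob_algebra N" and ne: "space M \<noteq> {}"
    and X [measurable]: "X \<in> M \<rightarrow>\<^sub>M S" and Y [measurable]: "Y \<in> M \<rightarrow>\<^sub>M N"
    and w [measurable]: "w \<in> borel_measurable M" and v [measurable]: "v \<in> borel_measurable M"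
    and fin: "(\<integral>\<^sup>+\<omega>. w \<omega> \<partial>M) \<noteq> \<infinity>"
    and rect: "\<And>B C. B \<in> sets S \<Longrightarrow> C \<in> sets N \<Longrightarrow>
      (\<integral>\<^sup>+\<omega>. w \<omega> * (indicator B (X \<omega>) * indicator C (Y \<omega>)) \<partial>M) =
      (\<integral>\<^sup>+\<omega>. v \<omega> * (indicator B (X \<omega>) * emeasure (K (X \<omega>)) C) \<partial>M)"
    and h [measurable]: "h \<in> borel_measurable (S \<Otimes>\<^sub>M N)"
  shows "(\<integral>\<^sup>+\<omega>. w \<omega> * h (X \<omega>, Y \<omega>) \<partial>M) = (\<integral>\<^sup>+\<omega>. v \<omega> * (\<integral>\<^sup>+y. h (X \<omega>, y) \<partial>K (X \<omega>)) \<partial>M)"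
proof -
  have Ks: "K \<in> S \<rightarrow>\<^sub>M subprob_algebra N" by (rule measurable_prob_algebraD[OF K])
  note Ks [measurable]
  have sK [measurable_cong]: "sets (K x) = sets N" if "x \<in> space S" for x
    using measurable_space[OF K that] by (auto simp: space_prob_algebra)
  have XS: "X \<omega> \<in> space S" if "\<omega> \<in> space M" for \<omega> using measurable_space[OF X that] .
  define P where "P = distr (density M w) (S \<Otimes>\<^sub>M N) (\<lambda>\<omega>. (X \<omega>, Y \<omega>))"
  define L where "L = distr (density M v) S X"
  define Q where "Q = L \<bind> (\<lambda>x. distr (K x) (S \<Otimes>\<^sub>M N) (Pair x))"
  have kern: "(\<lambda>x. distr (K x) (S \<Otimes>\<^sub>M N) (Pair x)) \<in> L \<rightarrow>\<^sub>M subprob_algebra (S \<Otimes>\<^sub>M N)"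
  proof -
    have "(\<lambda>x. distr (K x) (S \<Otimes>\<^sub>M N) (Pair x)) \<in> S \<rightarrow>\<^sub>M subprob_algebra (S \<Otimes>\<^sub>M N)"
      by (rule measurable_distr2[OF _ Ks]) simp
    then show ?thesis by (simp add: L_def cong: measurable_cong_sets)
  qed
  have spL: "space L \<noteq> {}" using ne XS by (auto simp: L_def)
  have P: "(\<integral>\<^sup>+z. f z \<partial>P) = (\<integral>\<^sup>+\<omega>. w \<omega> * f (X \<omega>, Y \<omega>) \<partial>M)"
    if [measurable]: "f \<in> borel_measurable (S \<Otimes>\<^sub>M N)" for f
    unfolding P_def by (subst nn_integral_distr, measurable, subst nn_integral_density) auto
  have Q: "(\<integral>\<^sup>+z. f z \<partial>Q) = (\<integral>\<^sup>+\<omega>. v \<omega> * (\<integral>\<^sup>+y. f (X \<omega>, y) \<partial>K (X \<omega>)) \<partial>M)"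
    if f [measurable]: "f \<in> borel_measurable (S \<Otimes>\<^sub>M N)" for f
  proof -
    have in_meas [measurable]: "(\<lambda>x. \<integral>\<^sup>+y. f (x, y) \<partial>K x) \<in> borel_measurable S"
      by (rule nn_integral_measurable_subprob_algebra2[OF _ Ks]) simp
    have "(\<integral>\<^sup>+z. f z \<partial>Q) = (\<integral>\<^sup>+x. (\<integral>\<^sup>+z. f z \<partial>distr (K x) (S \<Otimes>\<^sub>M N) (Pair x)) \<partial>L)"
      unfolding Q_def by (rule nn_integral_bind[OF f kern])
    also have "\<dots> = (\<integral>\<^sup>+x. (\<integral>\<^sup>+y. f (x, y) \<partial>K x) \<partial>L)"
    proof (rule nn_integral_cong)
      fix x assume "x \<in> space L"
      then have x: "x \<in> space S" by (simp add: L_def)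
      have "Pair x \<in> K x \<rightarrow>\<^sub>M S \<Otimes>\<^sub>M N"
        using measurable_Pair1'[OF x, of N] measurable_cong_sets[OF sK[OF x] refl] by blast
      then show "(\<integral>\<^sup>+z. f z \<partial>distr (K x) (S \<Otimes>\<^sub>M N) (Pair x)) = (\<integral>\<^sup>+y. f (x, y) \<partial>K x)"
        by (rule nn_integral_distr) simp
    qed
    also have "\<dots> = (\<integral>\<^sup>+\<omega>. v \<omega> * (\<integral>\<^sup>+y. f (X \<omega>, y) \<partial>K (X \<omega>)) \<partial>M)"
      unfolding L_def by (subst nn_integral_distr, simp, simp, subst nn_integral_density) simp_all
    finally show ?thesis .
  qed
  have setsP: "sets P = sets (S \<Otimes>\<^sub>M N)" by (simp add: P_def)
  have setsQ: "sets Q = sets (S \<Otimes>\<^sub>M N)"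
    unfolding Q_def by (rule sets_bind[OF _ spL]) simp
  have Prect: "emeasure P (B \<times> C) = (\<integral>\<^sup>+\<omega>. w \<omega> * (indicator B (X \<omega>) * indicator C (Y \<omega>)) \<partial>M)"
    if "B \<in> sets S" "C \<in> sets N" for B C
  proof -
    have "emeasure P (B \<times> C) = (\<integral>\<^sup>+z. indicator (B \<times> C) z \<partial>P)"
      using that by (simp add: setsP)
    also have "\<dots> = (\<integral>\<^sup>+\<omega>. w \<omega> * indicator (B \<times> C) (X \<omega>, Y \<omega>) \<partial>M)"
      using that by (intro P) simp
    finally show ?thesis by (simp add: indicator_times)
  qed
  have Qrect: "emeasure Q (B \<times> C) = (\<integral>\<^sup>+\<omega>. v \<omega> * (indicator B (X \<omega>) * emeasure (K (X \<omega>)) C) \<partial>M)"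
    if "B \<in> sets S" "C \<in> sets N" for B C
  proof -
    have "emeasure Q (B \<times> C) = (\<integral>\<^sup>+z. indicator (B \<times> C) z \<partial>Q)"
      using that by (simp add: setsQ)
    also have "\<dots> = (\<integral>\<^sup>+\<omega>. v \<omega> * (\<integral>\<^sup>+y. indicator (B \<times> C) (X \<omega>, y) \<partial>K (X \<omega>)) \<partial>M)"
      using that by (intro Q) simp
    also have "\<dots> = (\<integral>\<^sup>+\<omega>. v \<omega> * (\<integral>\<^sup>+y. indicator B (X \<omega>) * indicator C y \<partial>K (X \<omega>)) \<partial>M)"
      by (simp add: indicator_times)
    also have "\<dots> = (\<integral>\<^sup>+\<omega>. v \<omega> * (indicator B (X \<omega>) * emeasure (K (X \<omega>)) C) \<partial>M)"
      using that by (intro nn_integral_cong) (simp add: nn_integral_cmult_indicator sK XS)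
    finally show ?thesis .
  qed
  have "P = Q"
  proof (rule measure_eqI_generator_eq[where E = "{a \<times> b | a b. a \<in> sets S \<and> b \<in> sets N}"
        and \<Omega> = "space S \<times> space N" and A = "\<lambda>_. space S \<times> space N"])
    show "Int_stable {a \<times> b |a b. a \<in> sets S \<and> b \<in> sets N}"
      by (rule Int_stable_pair_measure_generator)
    show "{a \<times> b |a b. a \<in> sets S \<and> b \<in> sets N} \<subseteq> Pow (space S \<times> space N)"
      using sets.space_closed[of S] sets.space_closed[of N] by blast
    show "emeasure P Z = emeasure Q Z" if "Z \<in> {a \<times> b |a b. a \<in> sets S \<and> b \<in> sets N}" for Z
      using that Prect Qrect rect by auto
    show "emeasure P (space S \<times> space N) \<noteq> \<infinity>"
    proof -
      have "emeasure P (space S \<times> space N) = (\<integral>\<^sup>+\<omega>. w \<omega> \<partial>M)"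
        using measurable_space[OF X] measurable_space[OF Y]
        by (subst Prect) (auto intro!: nn_integral_cong)
      then show ?thesis using fin by simp
    qed
  qed (auto simp: setsP setsQ sets_pair_measure)
  then show ?thesis using P[OF h] Q[OF h] by simp
qed

lemma measurable_integral_kernel:
  fixes h :: "'a \<times> 'b \<Rightarrow> real"
  assumes K: "K \<in> S \<rightarrow>\<^sub>M prob_algebra N" and h [measurable]: "h \<in> borel_measurable (S \<Otimes>\<^sub>M N)"
    and nonneg: "\<And>z. 0 \<le> h z"
  shows "(\<lambda>s. \<integral>y. h (s, y) \<partial>K s) \<in> borel_measurable S"
proof -
  have "(\<integral>y. h (s, y) \<partial>K s) = enn2real (\<integral>\<^sup>+y. ennreal (h (s, y)) \<partial>K s)" if s: "s \<in> space S" for s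
  proof (rule integral_eq_nn_integral)
    have "sets (K s) = sets N"
      using measurable_space[OF K s] by (auto simp: space_prob_algebra)
    moreover have "(\<lambda>y. h (s, y)) \<in> borel_measurable N" using s by simp
    ultimately show "(\<lambda>y. h (s, y)) \<in> borel_measurable (K s)"
      using measurable_cong_sets by blast
  qed (simp add: nonneg)
  moreover have "(\<lambda>s. enn2real (\<integral>\<^sup>+y. ennreal (h (s, y)) \<partial>K s)) \<in> borel_measurable S"
    by (intro borel_measurable_enn2real
      nn_integral_measurable_subprob_algebra2[OF _ measurable_prob_algebraD[OF K]]) simp
  ultimately show ?thesis by (subst measurable_cong)
qed

lemma measurable_mark_law:
  assumes "PB \<in> borel \<rightarrow>\<^sub>M prob_algebra borel" "W \<in> borel \<rightarrow>\<^sub>M prob_algebra borel"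
  shows "mark_law PB W \<in> borel \<rightarrow>\<^sub>M prob_algebra mark_space"
  unfolding mark_law_def[abs_def] mark_space_def
  by (intro measurable_pair_prob measurable_PiM_kernel assms)

section \<open>Integrating out the marks\<close>

lemma marked_arrivals_poisson_stream:
  assumes "marked_arrivals M lam PB W A Bm S" "lam \<in> borel_measurable borel"
    "\<And>s. 0 \<le> s \<Longrightarrow> 0 \<le> lam s" "\<And>T. 0 \<le> T \<Longrightarrow> set_integrable lborel {0..T} lam"
  shows "poisson_stream M lam A"
  using assms unfolding marked_arrivals_def poisson_stream_def poisson_stream_axioms_def by blast

locale marked_stream = poisson_stream M lam A
  for M :: "'a measure" and lam A +
  fixes PB W :: "real \<Rightarrow> real measure" and Bm :: "nat \<Rightarrow> 'a \<Rightarrow> real" and S :: "nat \<Rightarrow> nat \<Rightarrow> 'a \<Rightarrow> real"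
  assumes model: "marked_arrivals M lam PB W A Bm S"
    and PB_kernel: "PB \<in> borel \<rightarrow>\<^sub>M prob_algebra borel"
    and W_kernel: "W \<in> borel \<rightarrow>\<^sub>M prob_algebra borel"
begin

abbreviation mark :: "nat \<Rightarrow> 'a \<Rightarrow> real \<times> (nat \<Rightarrow> real)" where
  "mark k \<omega> \<equiv> (Bm k \<omega>, \<lambda>j. S k j \<omega>)"

abbreviation kern :: "real \<Rightarrow> (real \<times> (nat \<Rightarrow> real)) measure" where
  "kern \<equiv> mark_law PB W"

lemma mark_measurable [measurable]: "mark k \<in> M \<rightarrow>\<^sub>M mark_space"
  using model unfolding marked_arrivals_def by blast

lemma indicator_count_measurable [measurable]:
  "(\<lambda>\<omega>. indicator {K} (A T \<omega>) :: ennreal) \<in> borel_measurable M"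
  by (rule measurable_compose[OF A_measurable]) simp

lemma indicator_mark_measurable [measurable]:
  "C \<in> sets mark_space \<Longrightarrow> (\<lambda>\<omega>. indicator C (mark k \<omega>) :: ennreal) \<in> borel_measurable M"
  by (rule measurable_compose[OF mark_measurable]) simp

lemma mark_compose_measurable:
  assumes "h \<in> borel_measurable (borel \<Otimes>\<^sub>M mark_space)" "X \<in> borel_measurable M"
  shows "(\<lambda>\<omega>. h (X \<omega>, mark k \<omega>)) \<in> borel_measurable M"
  by (rule measurable_compose[OF _ assms(1)]) (rule measurable_Pair[OF assms(2) mark_measurable])

lemma kern_measurable: "kern \<in> borel \<rightarrow>\<^sub>M prob_algebra mark_space"
  by (rule measurable_mark_law[OF PB_kernel W_kernel])

lemma prob_space_kern: "prob_space (kern s)" and sets_kern: "sets (kern s) = sets mark_space"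
  using measurable_space[OF kern_measurable, of s] by (auto simp: space_prob_algebra)

lemma emeasure_kern_measurable [measurable]:
  "C \<in> sets mark_space \<Longrightarrow> (\<lambda>s. emeasure (kern s) C) \<in> borel_measurable borel"
  by (rule measurable_emeasure_kernel[OF measurable_prob_algebraD[OF kern_measurable]])

text \<open>The model speaks of events in \<open>path_space\<close>, so the event \<open>D\<close>,
  that exactly \<open>K\<close> points occur up to \<open>T\<close> with arrival times in the given
  sets, has to be recognised as the preimage of such an event. An arbitrary element of the
  uncountable product need not be regular, so arrival times are not read off there. Instead
  \<open>D\<close> is measurable for the sigma-algebra \<open>F\<close> generated by the path on the
  sample space, where every path is a counting path, and membership in \<open>F\<close> yields the
  event.\<close>

lemma mark_rectangle_identity:
  assumes T: "0 \<le> T" and B: "\<And>k. B k \<in> sets borel" and C: "\<And>k. C k \<in> sets mark_space"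
  shows "(\<integral>\<^sup>+\<omega>. indicator {K} (A T \<omega>) *
        (\<Prod>k<K. indicator (B k) (trunc_arr A T k \<omega>) * indicator (C k) (mark k \<omega>)) \<partial>M) =
      (\<integral>\<^sup>+\<omega>. indicator {K} (A T \<omega>) *
        (\<Prod>k<K. indicator (B k) (trunc_arr A T k \<omega>) * emeasure (kern (trunc_arr A T k \<omega>)) (C k)) \<partial>M)"
proof -
  note [measurable] = B C
  have tr [measurable]: "trunc_arr A T k \<in> borel_measurable M" for k
    using T by simp
  let ?path = "\<lambda>\<omega> t. A t \<omega>"
  define F where "F = vimage_algebra (space M) ?path path_space"
  have sp: "space path_space = UNIV"
    by (auto simp: path_space_def space_PiM PiE_def)
  have path_F: "?path \<in> F \<rightarrow>\<^sub>M path_space"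
    unfolding F_def by (rule measurable_vimage_algebra1) (simp add: sp)
  have A_F [measurable]: "A t \<in> F \<rightarrow>\<^sub>M count_space UNIV" for t
  proof -
    have "(\<lambda>f. f t) \<in> path_space \<rightarrow>\<^sub>M count_space UNIV"
      unfolding path_space_def by (rule measurable_component_singleton) simp
    from measurable_compose[OF path_F this] show ?thesis .
  qed
  have [measurable]: "trunc_arr A T k \<in> borel_measurable F" for k
    by (rule trunc_arr_measurable[OF A_F _ T]) (simp add: F_def path)
  define D where "D = {\<omega>\<in>space M. A T \<omega> = K \<and> (\<forall>k<K. trunc_arr A T k \<omega> \<in> B k)}"
  have "{\<omega>\<in>space F. A T \<omega> = K \<and> (\<forall>k<K. trunc_arr A T k \<omega> \<in> B k)} \<in> sets F"
    by measurable
  then have "D \<in> sets F" by (simp add: D_def F_def)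
  then obtain E0 where E0: "E0 \<in> sets path_space" "D = ?path -` E0 \<inter> space M"
    unfolding F_def by (subst (asm) sets_vimage_algebra2) (auto simp: sp)
  \<comment> \<open>Membership in \<open>sets F\<close> says nothing about \<open>E0\<close> away
    from realised paths. Intersecting with \<open>f T = K\<close> makes every element reach
    \<open>K\<close>, as the model demands, and leaves the preimage \<open>D\<close>
    unchanged.\<close>
  define E where "E = E0 \<inter> {f \<in> space path_space. f T = K}"
  have "{f \<in> space path_space. f T = K} \<in> sets path_space"
    unfolding path_space_def by measurable
  then have E: "E \<in> sets path_space" using E0 by (simp add: E_def)
  have E_sub: "E \<subseteq> {f. \<exists>t\<ge>0. K \<le> f t}" using T by (auto simp: E_def)
  have inE: "?path \<omega> \<in> E \<longleftrightarrow> \<omega> \<in> D" if "\<omega> \<in> space M" for \<omega>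
    using E0(2) that by (auto simp: E_def D_def sp)
  have D [measurable]: "D \<in> sets M" unfolding D_def by measurable
  have id: "measure M {\<omega>\<in>space M. ?path \<omega> \<in> E \<and> (\<forall>k<K. mark k \<omega> \<in> C k)} =
      (\<integral>\<omega>. indicator E (?path \<omega>) * (\<Prod>k<K. measure (kern (arr_time (?path \<omega>) k)) (C k)) \<partial>M)"
    using model E E_sub C unfolding marked_arrivals_def by blast
  have "(\<integral>\<^sup>+\<omega>. indicator {K} (A T \<omega>) *
        (\<Prod>k<K. indicator (B k) (trunc_arr A T k \<omega>) * indicator (C k) (mark k \<omega>)) \<partial>M) =
      (\<integral>\<^sup>+\<omega>. indicator {\<omega>\<in>space M. ?path \<omega> \<in> E \<and> (\<forall>k<K. mark k \<omega> \<in> C k)} \<omega> \<partial>M)"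
  proof (rule nn_integral_cong)
    fix \<omega> assume \<omega>: "\<omega> \<in> space M"
    have "(\<Prod>k<K. indicator (B k) (trunc_arr A T k \<omega>) * indicator (C k) (mark k \<omega>)) =
        (if \<forall>k<K. trunc_arr A T k \<omega> \<in> B k \<and> mark k \<omega> \<in> C k then 1 else 0 :: ennreal)"
    proof (cases "\<forall>k<K. trunc_arr A T k \<omega> \<in> B k \<and> mark k \<omega> \<in> C k")
      case False
      then obtain k where "k < K" "\<not> (trunc_arr A T k \<omega> \<in> B k \<and> mark k \<omega> \<in> C k)" by blast
      then have "(\<Prod>k<K. indicator (B k) (trunc_arr A T k \<omega>) * indicator (C k) (mark k \<omega>)) = (0 :: ennreal)"
        by (intro prod_zero) (auto simp: indicator_def)
      then show ?thesis by (simp only: False if_False)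
    qed (auto intro!: prod.neutral simp: indicator_def)
    then show "indicator {K} (A T \<omega>) *
        (\<Prod>k<K. indicator (B k) (trunc_arr A T k \<omega>) * indicator (C k) (mark k \<omega>)) =
        (indicator {\<omega>\<in>space M. ?path \<omega> \<in> E \<and> (\<forall>k<K. mark k \<omega> \<in> C k)} \<omega> :: ennreal)"
      using \<omega> inE[OF \<omega>] by (auto simp: D_def indicator_def)
  qed
  also have "\<dots> = emeasure M {\<omega>\<in>space M. ?path \<omega> \<in> E \<and> (\<forall>k<K. mark k \<omega> \<in> C k)}"
  proof (rule nn_integral_indicator)
    have "{\<omega>\<in>space M. ?path \<omega> \<in> E \<and> (\<forall>k<K. mark k \<omega> \<in> C k)} = D \<inter> {\<omega>\<in>space M. \<forall>k<K. mark k \<omega> \<in> C k}"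
      using inE by (auto simp: D_def)
    moreover have "{\<omega>\<in>space M. \<forall>k<K. mark k \<omega> \<in> C k} \<in> sets M" by measurable
    ultimately show "{\<omega>\<in>space M. ?path \<omega> \<in> E \<and> (\<forall>k<K. mark k \<omega> \<in> C k)} \<in> sets M" by simp
  qed
  \<comment> \<open>On \<open>D\<close> the count at \<open>T\<close> is \<open>K\<close>, so
    truncated and true arrival times agree for all \<open>k < K\<close>.\<close>
  also have "\<dots> = ennreal (\<integral>\<omega>. indicator D \<omega> * (\<Prod>k<K. measure (kern (trunc_arr A T k \<omega>)) (C k)) \<partial>M)"
    unfolding emeasure_eq_measure id
    using inE by (intro arg_cong[where f = ennreal] Bochner_Integration.integral_cong refl)
      (auto simp: indicator_def D_def trunc_arr_def)
  also have "\<dots> = (\<integral>\<^sup>+\<omega>. ennreal (indicator D \<omega> * (\<Prod>k<K. measure (kern (trunc_arr A T k \<omega>)) (C k))) \<partial>M)"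
  proof (rule nn_integral_eq_integral[symmetric])
    have 1: "measure (kern s) (C k) \<le> 1" for s k
      using prob_space.prob_le_1[OF prob_space_kern] .
    have [measurable]: "(\<lambda>s. measure (kern s) (C k)) \<in> borel_measurable borel" for k
      unfolding measure_def by measurable
    have "0 \<le> (\<Prod>k<K. measure (kern (f k)) (C k))" "(\<Prod>k<K. measure (kern (f k)) (C k)) \<le> 1" for f
      by (auto intro!: prod_nonneg prod_le_1 simp: 1)
    then show "integrable M (\<lambda>\<omega>. indicator D \<omega> * (\<Prod>k<K. measure (kern (trunc_arr A T k \<omega>)) (C k)))"
      by (intro integrable_const_bound[of _ 1]) (auto simp: indicator_def)
    show "AE \<omega> in M. 0 \<le> indicator D \<omega> * (\<Prod>k<K. measure (kern (trunc_arr A T k \<omega>)) (C k))"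
      by (intro AE_I2 mult_nonneg_nonneg prod_nonneg) auto
  qed
  also have "\<dots> = (\<integral>\<^sup>+\<omega>. indicator {K} (A T \<omega>) *
        (\<Prod>k<K. indicator (B k) (trunc_arr A T k \<omega>) * emeasure (kern (trunc_arr A T k \<omega>)) (C k)) \<partial>M)"
  proof (rule nn_integral_cong)
    fix \<omega> assume \<omega>: "\<omega> \<in> space M"
    have "emeasure (kern s) X = ennreal (measure (kern s) X)" for s X
      using prob_space.finite_measure[OF prob_space_kern] by (rule finite_measure.emeasure_eq_measure)
    then have "(\<Prod>k<K. emeasure (kern (trunc_arr A T k \<omega>)) (C k)) =
        ennreal (\<Prod>k<K. measure (kern (trunc_arr A T k \<omega>)) (C k))"
      by (simp add: prod_ennreal)
    moreover have "(\<Prod>k<K. indicator (B k) (trunc_arr A T k \<omega>)) =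
        (if \<forall>k<K. trunc_arr A T k \<omega> \<in> B k then 1 else 0 :: ennreal)"
    proof (cases "\<forall>k<K. trunc_arr A T k \<omega> \<in> B k")
      case False
      then have "(\<Prod>k<K. indicator (B k) (trunc_arr A T k \<omega>)) = (0 :: ennreal)"
        by (intro prod_zero) (auto simp: indicator_def)
      then show ?thesis by (simp only: False if_False)
    qed (auto intro!: prod.neutral simp: indicator_def)
    ultimately show "ennreal (indicator D \<omega> * (\<Prod>k<K. measure (kern (trunc_arr A T k \<omega>)) (C k))) =
      indicator {K} (A T \<omega>) *
        (\<Prod>k<K. indicator (B k) (trunc_arr A T k \<omega>) * emeasure (kern (trunc_arr A T k \<omega>)) (C k))"
      using \<omega> by (auto simp: prod.distrib D_def indicator_def)
  qed
  finally show ?thesis .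
qed

lemma nn_integral_kern_measurable:
  assumes "h \<in> borel_measurable (borel \<Otimes>\<^sub>M mark_space)"
  shows "(\<lambda>s. \<integral>\<^sup>+y. h (s, y) \<partial>kern s) \<in> borel_measurable borel"
  by (rule nn_integral_measurable_subprob_algebra2[OF _ measurable_prob_algebraD[OF kern_measurable]])
    (use assms in simp)

text \<open>The factors indexed below \<open>j\<close> have already been integrated against the kernel as functions, the
  others are still indicators of rectangles; \<open>j\<close> is increased one at a time.\<close>
lemma mark_partial_identity:
  assumes T: "0 \<le> T" and h [measurable]: "h \<in> borel_measurable (borel \<Otimes>\<^sub>M mark_space)"
    and h1: "\<And>z. h z \<le> (1 :: ennreal)"
    and "j \<le> K" and B: "\<And>k. B k \<in> sets borel" and C: "\<And>k. C k \<in> sets mark_space"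
  shows "(\<integral>\<^sup>+\<omega>. indicator {K} (A T \<omega>) * ((\<Prod>k<j. h (trunc_arr A T k \<omega>, mark k \<omega>)) *
        (\<Prod>k=j..<K. indicator (B k) (trunc_arr A T k \<omega>) * indicator (C k) (mark k \<omega>))) \<partial>M) =
      (\<integral>\<^sup>+\<omega>. indicator {K} (A T \<omega>) * ((\<Prod>k<j. \<integral>\<^sup>+y. h (trunc_arr A T k \<omega>, y) \<partial>kern (trunc_arr A T k \<omega>)) *
        (\<Prod>k=j..<K. indicator (B k) (trunc_arr A T k \<omega>) * emeasure (kern (trunc_arr A T k \<omega>)) (C k))) \<partial>M)"
  using \<open>j \<le> K\<close> B C
proof (induction j arbitrary: B C)
  case 0
  then show ?case
    using mark_rectangle_identity[OF T, of B C K] by (simp add: lessThan_atLeast0)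
next
  case (Suc j)
  note [measurable] = Suc.prems(2,3)
  from Suc.prems(1) have j: "j < K" by simp
  have tr [measurable]: "trunc_arr A T k \<in> borel_measurable M" for k
    using T by simp
  define H where "H s = (\<integral>\<^sup>+y. h (s, y) \<partial>kern s)" for s
  have [measurable]: "H \<in> borel_measurable borel"
    unfolding H_def[abs_def] by (rule nn_integral_kern_measurable[OF h])
  let ?x = "\<lambda>k \<omega>. trunc_arr A T k \<omega>"
  \<comment> \<open>All factors except that of batch \<open>j\<close>: \<open>w\<close> with the
    marks still in place, \<open>v\<close> with the marks integrated out.\<close>
  define w where "w \<omega> = indicator {K} (A T \<omega>) * ((\<Prod>k<j. h (?x k \<omega>, mark k \<omega>)) *
        (\<Prod>k=Suc j..<K. indicator (B k) (?x k \<omega>) * indicator (C k) (mark k \<omega>)))" for \<omega>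
  define v where "v \<omega> = indicator {K} (A T \<omega>) * ((\<Prod>k<j. H (?x k \<omega>)) *
        (\<Prod>k=Suc j..<K. indicator (B k) (?x k \<omega>) * emeasure (kern (?x k \<omega>)) (C k)))" for \<omega>
  have factors: "(\<lambda>\<omega>. indicator (B k) (?x k \<omega>) :: ennreal) \<in> borel_measurable M"
    "(\<lambda>\<omega>. H (?x k \<omega>)) \<in> borel_measurable M"
    "(\<lambda>\<omega>. emeasure (kern (?x k \<omega>)) (C k)) \<in> borel_measurable M" for k
    by (simp_all add: measurable_compose[OF tr emeasure_kern_measurable] Suc.prems(3))
  have [measurable]: "w \<in> borel_measurable M" "v \<in> borel_measurable M"
    unfolding w_def[abs_def] v_def[abs_def]
    by (intro borel_measurable_times_ennreal borel_measurable_prod_ennreal indicator_count_measurable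
      indicator_mark_measurable Suc.prems mark_compose_measurable[OF h] factors tr)+
  have "(\<integral>\<^sup>+\<omega>. w \<omega> * h (?x j \<omega>, mark j \<omega>) \<partial>M) = (\<integral>\<^sup>+\<omega>. v \<omega> * (\<integral>\<^sup>+y. h (?x j \<omega>, y) \<partial>kern (?x j \<omega>)) \<partial>M)"
  proof (rule nn_integral_kernel_replace[OF kern_measurable not_empty])
    have "w \<omega> \<le> 1 * (1 * 1)" for \<omega>
      unfolding w_def by (intro mult_mono prod_le_1) (auto simp: h1 indicator_def)
    then have "(\<integral>\<^sup>+\<omega>. w \<omega> \<partial>M) \<le> (\<integral>\<^sup>+\<omega>. 1 \<partial>M)"
      by (intro nn_integral_mono) simp
    then show "(\<integral>\<^sup>+\<omega>. w \<omega> \<partial>M) \<noteq> \<infinity>"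
      by (auto simp: emeasure_space_1 top_unique)
    fix B' :: "real set" and C' assume [measurable]: "B' \<in> sets borel" "C' \<in> sets mark_space"
    have split: "(\<Prod>k=j..<K. f k) = f j * (\<Prod>k=Suc j..<K. f k)" for f :: "nat \<Rightarrow> ennreal"
      using j by (rule prod.atLeast_Suc_lessThan)
    have upd: "(\<Prod>k=Suc j..<K. f (B(j := B')) (C(j := C')) k) = (\<Prod>k=Suc j..<K. f B C k)"
      if "\<And>k. k \<noteq> j \<Longrightarrow> f (B(j := B')) (C(j := C')) k = f B C k"
      for f :: "(nat \<Rightarrow> real set) \<Rightarrow> (nat \<Rightarrow> (real \<times> (nat \<Rightarrow> real)) set) \<Rightarrow> nat \<Rightarrow> ennreal"
      using that by (intro prod.cong) auto
    \<comment> \<open>A rectangle for batch \<open>j\<close> is absorbed by updating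
      \<open>B\<close> and \<open>C\<close> at \<open>j\<close>, so the required identity is the
      induction hypothesis for the updated families.\<close>
    have "(\<integral>\<^sup>+\<omega>. w \<omega> * (indicator B' (?x j \<omega>) * indicator C' (mark j \<omega>)) \<partial>M) =
        (\<integral>\<^sup>+\<omega>. indicator {K} (A T \<omega>) * ((\<Prod>k<j. h (?x k \<omega>, mark k \<omega>)) *
          (\<Prod>k=j..<K. indicator ((B(j := B')) k) (?x k \<omega>) * indicator ((C(j := C')) k) (mark k \<omega>))) \<partial>M)"
      unfolding w_def split by (intro nn_integral_cong, subst upd) (simp_all add: mult_ac)
    also have "\<dots> = (\<integral>\<^sup>+\<omega>. indicator {K} (A T \<omega>) * ((\<Prod>k<j. H (?x k \<omega>)) *
          (\<Prod>k=j..<K. indicator ((B(j := B')) k) (?x k \<omega>) * emeasure (kern (?x k \<omega>)) ((C(j := C')) k))) \<partial>M)"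
      unfolding H_def using j by (intro Suc.IH) auto
    also have "\<dots> = (\<integral>\<^sup>+\<omega>. v \<omega> * (indicator B' (?x j \<omega>) * emeasure (kern (?x j \<omega>)) C') \<partial>M)"
      unfolding v_def split by (intro nn_integral_cong, subst upd) (simp_all add: mult_ac)
    finally show "(\<integral>\<^sup>+\<omega>. w \<omega> * (indicator B' (?x j \<omega>) * indicator C' (mark j \<omega>)) \<partial>M) =
      (\<integral>\<^sup>+\<omega>. v \<omega> * (indicator B' (?x j \<omega>) * emeasure (kern (?x j \<omega>)) C') \<partial>M)" .
  qed simp_all
  then show ?case
    unfolding w_def v_def H_def by (simp add: mult_ac)
qed

text \<open>Since the number of factors is random, both sides are split over the value
  \<open>K\<close> of the count; for fixed \<open>K\<close> the marks are integrated out factor by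
  factor.\<close>

lemma nn_integral_marks:
  assumes T: "0 \<le> T" and h [measurable]: "h \<in> borel_measurable (borel \<Otimes>\<^sub>M mark_space)"
    and h1: "\<And>z. h z \<le> (1 :: ennreal)"
  shows "(\<integral>\<^sup>+\<omega>. (\<Prod>k<A T \<omega>. h (arr_time (\<lambda>u. A u \<omega>) k, mark k \<omega>)) \<partial>M) =
    (\<integral>\<^sup>+\<omega>. (\<Prod>k<A T \<omega>. \<integral>\<^sup>+y. h (arr_time (\<lambda>u. A u \<omega>) k, y) \<partial>kern (arr_time (\<lambda>u. A u \<omega>) k)) \<partial>M)"
proof -
  have [measurable]: "trunc_arr A T k \<in> borel_measurable M" for k
    using T by simp
  note [measurable] = nn_integral_kern_measurable[OF h]
  let ?H = "\<lambda>s. \<integral>\<^sup>+y. h (s, y) \<partial>kern s"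
  have series: "(\<integral>\<^sup>+\<omega>. (\<Prod>k<A T \<omega>. f k \<omega>) \<partial>M) = (\<Sum>K. \<integral>\<^sup>+\<omega>. indicator {K} (A T \<omega>) * (\<Prod>k<K. f k \<omega>) \<partial>M)"
    if [measurable]: "\<And>k. f k \<in> borel_measurable M" for f :: "nat \<Rightarrow> 'a \<Rightarrow> ennreal"
  proof -
    have "(\<Prod>k<A T \<omega>. f k \<omega>) = (\<Sum>K. indicator {K} (A T \<omega>) * (\<Prod>k<K. f k \<omega>))" for \<omega>
    proof -
      have "(\<Sum>K. indicator {K} (A T \<omega>) * (\<Prod>k<K. f k \<omega>)) =
          (\<Sum>K\<in>{A T \<omega>}. indicator {K} (A T \<omega>) * (\<Prod>k<K. f k \<omega>))"
        by (rule suminf_finite) auto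
      then show ?thesis by simp
    qed
    then show ?thesis by (simp add: nn_integral_suminf)
  qed
  have "(\<integral>\<^sup>+\<omega>. (\<Prod>k<A T \<omega>. h (arr_time (\<lambda>u. A u \<omega>) k, mark k \<omega>)) \<partial>M) =
      (\<integral>\<^sup>+\<omega>. (\<Prod>k<A T \<omega>. h (trunc_arr A T k \<omega>, mark k \<omega>)) \<partial>M)"
    by (simp add: trunc_arr_def)
  also have "\<dots> = (\<Sum>K. \<integral>\<^sup>+\<omega>. indicator {K} (A T \<omega>) * (\<Prod>k<K. h (trunc_arr A T k \<omega>, mark k \<omega>)) \<partial>M)"
    by (rule series) (rule mark_compose_measurable[OF h], simp)
  also have "\<dots> = (\<Sum>K. \<integral>\<^sup>+\<omega>. indicator {K} (A T \<omega>) * (\<Prod>k<K. ?H (trunc_arr A T k \<omega>)) \<partial>M)"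
    \<comment> \<open>At \<open>j = K\<close> the product of rectangles is empty, so the choice of
      sets is immaterial.\<close>
    using mark_partial_identity[OF T h h1 order_refl, of "\<lambda>_. {}" "\<lambda>_. {}"]
    by (intro suminf_cong) simp
  also have "\<dots> = (\<integral>\<^sup>+\<omega>. (\<Prod>k<A T \<omega>. ?H (trunc_arr A T k \<omega>)) \<partial>M)"
    by (rule series[symmetric]) simp
  also have "\<dots> = (\<integral>\<^sup>+\<omega>. (\<Prod>k<A T \<omega>. ?H (arr_time (\<lambda>u. A u \<omega>) k)) \<partial>M)"
    by (simp add: trunc_arr_def)
  finally show ?thesis .
qed

theorem marked_poisson_functional:
  assumes T: "0 < T" and h [measurable]: "h \<in> borel_measurable (borel \<Otimes>\<^sub>M mark_space)"
    and h01: "\<And>z. 0 \<le> h z \<and> h z \<le> (1 :: real)"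
  shows "expectation (\<lambda>\<omega>. \<Prod>k<A T \<omega>. h (arr_time (\<lambda>u. A u \<omega>) k, mark k \<omega>)) =
    exp (- (LINT s:{0..T}|lborel. (1 - (\<integral>y. h (s, y) \<partial>kern s)) * lam s))"
proof -
  have h0: "0 \<le> h z" and h1: "h z \<le> 1" for z using h01[of z] by blast+
  have T0: "0 \<le> T" using T by simp
  define H where "H s = (\<integral>y. h (s, y) \<partial>kern s)" for s
  have hs: "(\<lambda>y. h (s, y)) \<in> borel_measurable (kern s)" for s
  proof -
    have "(\<lambda>y. h (s, y)) \<in> borel_measurable mark_space" by simp
    then show ?thesis using measurable_cong_sets[OF sets_kern refl] by blast
  qed
  have nnH: "(\<integral>\<^sup>+y. ennreal (h (s, y)) \<partial>kern s) = ennreal (H s)" for s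
  proof -
    interpret K: prob_space "kern s" by (rule prob_space_kern)
    have "integrable (kern s) (\<lambda>y. h (s, y))"
      by (rule K.integrable_const_bound[OF _ hs, of 1]) (simp add: h0 h1)
    then show ?thesis unfolding H_def by (rule nn_integral_eq_integral) (simp add: h0)
  qed
  have H0: "0 \<le> H s" for s unfolding H_def by (rule integral_nonneg_AE) (simp add: h0)
  have H1: "H s \<le> 1" for s
  proof -
    have "ennreal (H s) \<le> (\<integral>\<^sup>+y. 1 \<partial>kern s)"
      unfolding nnH[symmetric] by (intro nn_integral_mono) (simp add: ennreal_le_1 h1)
    then show ?thesis
      using prob_space.emeasure_space_1[OF prob_space_kern, of s] by (simp add: ennreal_le_1)
  qed
  have Hm: "H \<in> borel_measurable borel"
    unfolding H_def[abs_def] by (rule measurable_integral_kernel[OF kern_measurable h h0])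
  let ?P = "\<lambda>\<omega>. \<Prod>k<A T \<omega>. h (arr_time (\<lambda>u. A u \<omega>) k, mark k \<omega>)"
  have P0: "0 \<le> ?P \<omega>" and P1: "?P \<omega> \<le> 1" for \<omega>
    by (simp_all add: prod_nonneg prod_le_1 h0 h1)
  have "(\<lambda>\<omega>. \<Prod>k<A T \<omega>. h (trunc_arr A T k \<omega>, mark k \<omega>)) \<in> borel_measurable M"
    by (rule measurable_compose_countable[OF _ A_measurable])
      (intro borel_measurable_prod mark_compose_measurable[OF h] trunc_arr_borel T0)
  also have "(\<lambda>\<omega>. \<Prod>k<A T \<omega>. h (trunc_arr A T k \<omega>, mark k \<omega>)) = ?P"
    by (intro ext prod.cong refl) (simp add: trunc_arr_def)
  finally have Pm: "?P \<in> borel_measurable M" .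
  have "ennreal (expectation ?P) = (\<integral>\<^sup>+\<omega>. ennreal (?P \<omega>) \<partial>M)"
    by (intro nn_integral_eq_integral[symmetric] integrable_const_bound[OF _ Pm, of 1] AE_I2)
      (simp_all only: P0 P1 real_norm_def abs_of_nonneg)
  also have "\<dots> = (\<integral>\<^sup>+\<omega>. (\<Prod>k<A T \<omega>. ennreal (h (arr_time (\<lambda>u. A u \<omega>) k, mark k \<omega>))) \<partial>M)"
    by (simp add: prod_ennreal h0)
  also have "\<dots> = (\<integral>\<^sup>+\<omega>. (\<Prod>k<A T \<omega>. \<integral>\<^sup>+y. ennreal (h (arr_time (\<lambda>u. A u \<omega>) k, y)) \<partial>kern (arr_time (\<lambda>u. A u \<omega>) k)) \<partial>M)"
    by (rule nn_integral_marks[OF T0]) (simp_all add: ennreal_le_1 h1)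
  also have "\<dots> = (\<integral>\<^sup>+\<omega>. ennreal (arrival_product T H \<omega>) \<partial>M)"
    by (simp add: nnH arrival_product_def prod_ennreal H0)
  also have "\<dots> = ennreal (expectation (arrival_product T H))"
    using arrival_product_bounds[of H T] H0 H1
    by (intro nn_integral_eq_integral integrable_const_bound[OF _ arrival_product_measurable[OF T0 Hm], of 1])
      simp_all
  finally have "expectation ?P = expectation (arrival_product T H)"
    using arrival_product_bounds(1)[of H T] H0 H1
    by (subst (asm) ennreal_inj) (simp_all add: P0)
  also have "\<dots> = exp (- (LINT s:{0..T}|lborel. (1 - H s) * lam s))"
    by (rule poisson_functional[OF T Hm]) (simp add: H0 H1)
  finally show ?thesis by (simp only: H_def)
qed

end

section \<open>Batch weights\<close>

text \<open>Contribution to the exponent, before division by \<open>n\<close>, of a single customer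
  arriving at \<open>s\<close> with work \<open>w\<close>. The guard \<open>s \<le> t x\<close>
  discards observation times preceding the arrival, which allows all arrivals up to the last time to
  be treated alike.\<close>

definition work_cost :: "nat \<Rightarrow> (nat \<Rightarrow> real) \<Rightarrow> (nat \<Rightarrow> real) \<Rightarrow> (nat \<Rightarrow> real) \<Rightarrow> real \<Rightarrow> real \<Rightarrow> real" where
  "work_cost m t \<alpha> \<beta> s w = (\<Sum>x=1..m. if s \<le> t x then
     \<alpha> x * of_bool (t x < s + w) + \<beta> x * of_bool (0 < s + w \<and> s + w \<le> t x) else 0)"

definition batch_weight ::
  "nat \<Rightarrow> (nat \<Rightarrow> real) \<Rightarrow> (nat \<Rightarrow> real) \<Rightarrow> (nat \<Rightarrow> real) \<Rightarrow> nat \<Rightarrow> real \<times> real \<times> (nat \<Rightarrow> real) \<Rightarrow> real" where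
  "batch_weight m t \<alpha> \<beta> n z = (\<Prod>j<nat \<lceil>real n * fst (snd z)\<rceil>.
     exp (- (work_cost m t \<alpha> \<beta> (fst z) (snd (snd z) j) / real n)))"

lemma card_lessThan_filter:
  fixes N :: nat
  shows "real (card {j. j < N \<and> P j}) = (\<Sum>j<N. of_bool (P j))"
proof -
  have "{j. j < N \<and> P j} = {..<N} \<inter> Collect P" by auto
  then show ?thesis by (simp add: of_bool_def sum.If_cases)
qed

text \<open>Different observation times see different numbers of arrivals; this brings their sums to
  the common range below \<open>f T\<close>, at the price of a guard.\<close>

lemma sum_arrivals_before:
  assumes p: "counting_path f" and "0 \<le> a" "a \<le> T"
  shows "(\<Sum>k<f a. g k) = (\<Sum>k<f T. if arr_time f k \<le> a then g k else (0 :: real))"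
proof -
  have T: "0 \<le> T" using assms by simp
  have "f a \<le> f T" using counting_path_mono[OF p assms(2,3)] .
  then have "{..<f a} = {k\<in>{..<f T}. arr_time f k \<le> a}"
    using arr_time_le_iff[OF p T _ assms(2)] by auto
  then show ?thesis by (simp only: sum.inter_filter[OF finite_lessThan])
qed

text \<open>Interchanging the sums over observation times and over customers makes the exponent a
  sum of costs over batches and their members, which \<open>exp\<close> turns into a
  product.\<close>

lemma exp_cost_eq_prod_batch_weight:
  assumes p: "counting_path (\<lambda>u. A u \<omega>)"
    and t: "\<And>k. 1 \<le> k \<Longrightarrow> k \<le> m \<Longrightarrow> 0 \<le> t k \<and> t k \<le> T"
  shows "exp (- (\<Sum>k=1..m. \<alpha> k * (real (queue_len n A Bm S (t k) \<omega>) / real n) +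
              \<beta> k * (real (departures n A Bm S (t k) \<omega>) / real n))) =
    (\<Prod>k<A T \<omega>. batch_weight m t \<alpha> \<beta> n (arr_time (\<lambda>u. A u \<omega>) k, Bm k \<omega>, \<lambda>j. S k j \<omega>))"
proof -
  let ?a = "arr_time (\<lambda>u. A u \<omega>)"
  let ?N = "\<lambda>k. nat \<lceil>real n * Bm k \<omega>\<rceil>"
  have q: "real (queue_len n A Bm S (t x) \<omega>) =
      (\<Sum>k<A T \<omega>. if ?a k \<le> t x then (\<Sum>j<?N k. of_bool (t x < ?a k + S k j \<omega>)) else 0)"
    if "x \<in> {1..m}" for x
    unfolding queue_len_def using that t[of x]
    by (simp add: card_lessThan_filter sum_arrivals_before[OF p, of "t x" T] del: sum_of_bool_eq)
  have d: "real (departures n A Bm S (t x) \<omega>) =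
      (\<Sum>k<A T \<omega>. if ?a k \<le> t x then
        (\<Sum>j<?N k. of_bool (0 < ?a k + S k j \<omega> \<and> ?a k + S k j \<omega> \<le> t x)) else 0)"
    if "x \<in> {1..m}" for x
    unfolding departures_def using that t[of x]
    by (simp add: card_lessThan_filter sum_arrivals_before[OF p, of "t x" T] del: sum_of_bool_eq)
  have "(\<Sum>k=1..m. \<alpha> k * (real (queue_len n A Bm S (t k) \<omega>) / real n) +
              \<beta> k * (real (departures n A Bm S (t k) \<omega>) / real n)) =
      (\<Sum>x=1..m. \<Sum>k<A T \<omega>. \<Sum>j<?N k. (if ?a k \<le> t x then \<alpha> x * of_bool (t x < ?a k + S k j \<omega>) +
        \<beta> x * of_bool (0 < ?a k + S k j \<omega> \<and> ?a k + S k j \<omega> \<le> t x) else 0) / real n)"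
  proof (rule sum.cong[OF refl])
    fix x assume x: "x \<in> {1..m}"
    have dist: "a * ((if c then \<Sum>j<N. u j else 0) / r) + b * ((if c then \<Sum>j<N. v j else 0) / r) =
        (\<Sum>j<N. (if c then a * u j + b * v j else 0) / r)"
      for a b r :: real and c and u v :: "nat \<Rightarrow> real" and N
      by (simp add: sum_distrib_left sum_divide_distrib sum.distrib add_divide_distrib)
    show "\<alpha> x * (real (queue_len n A Bm S (t x) \<omega>) / real n) + \<beta> x * (real (departures n A Bm S (t x) \<omega>) / real n) =
      (\<Sum>k<A T \<omega>. \<Sum>j<?N k. (if ?a k \<le> t x then \<alpha> x * of_bool (t x < ?a k + S k j \<omega>) +
        \<beta> x * of_bool (0 < ?a k + S k j \<omega> \<and> ?a k + S k j \<omega> \<le> t x) else 0) / real n)"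
      unfolding q[OF x] d[OF x] sum_divide_distrib sum_distrib_left sum.distrib[symmetric]
      by (intro sum.cong refl dist)
  qed
  also have "\<dots> = (\<Sum>k<A T \<omega>. \<Sum>j<?N k. \<Sum>x=1..m. (if ?a k \<le> t x then \<alpha> x * of_bool (t x < ?a k + S k j \<omega>) +
        \<beta> x * of_bool (0 < ?a k + S k j \<omega> \<and> ?a k + S k j \<omega> \<le> t x) else 0) / real n)"
    by (rule trans[OF sum.swap]) (rule sum.cong[OF refl sum.swap])
  also have "\<dots> = (\<Sum>k<A T \<omega>. \<Sum>j<?N k. work_cost m t \<alpha> \<beta> (?a k) (S k j \<omega>) / real n)"
    unfolding work_cost_def by (simp only: sum_divide_distrib)
  finally show ?thesis
    by (simp add: batch_weight_def exp_sum flip: sum_negf)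
qed

lemma work_cost_nonneg:
  assumes "\<And>k. 1 \<le> k \<Longrightarrow> k \<le> m \<Longrightarrow> 0 \<le> \<alpha> k" "\<And>k. 1 \<le> k \<Longrightarrow> k \<le> m \<Longrightarrow> 0 \<le> \<beta> k"
  shows "0 \<le> work_cost m t \<alpha> \<beta> s w"
  unfolding work_cost_def using assms by (intro sum_nonneg) auto

lemma work_cost_le:
  assumes "\<And>k. 1 \<le> k \<Longrightarrow> k \<le> m \<Longrightarrow> 0 \<le> \<alpha> k" "\<And>k. 1 \<le> k \<Longrightarrow> k \<le> m \<Longrightarrow> 0 \<le> \<beta> k"
  shows "work_cost m t \<alpha> \<beta> s w \<le> (\<Sum>x=1..m. \<alpha> x + \<beta> x)"
  unfolding work_cost_def
proof (rule sum_mono)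
  fix x assume "x \<in> {1..m}"
  then have "0 \<le> \<alpha> x" "0 \<le> \<beta> x" using assms by auto
  then show "(if s \<le> t x then \<alpha> x * of_bool (t x < s + w) +
      \<beta> x * of_bool (0 < s + w \<and> s + w \<le> t x) else 0) \<le> \<alpha> x + \<beta> x"
    by (auto simp: of_bool_def)
qed

lemma work_cost_measurable2 [measurable (raw)]:
  assumes [measurable]: "f \<in> borel_measurable N" "g \<in> borel_measurable N"
  shows "(\<lambda>x. work_cost m t \<alpha> \<beta> (f x) (g x)) \<in> borel_measurable N"
  unfolding work_cost_def of_bool_def by measurable

lemma batch_weight_measurable [measurable]:
  "batch_weight m t \<alpha> \<beta> n \<in> borel_measurable (borel \<Otimes>\<^sub>M mark_space)"
  unfolding batch_weight_def[abs_def] mark_space_def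
  by (rule measurable_compose_countable[where g = "\<lambda>z. nat \<lceil>real n * fst (snd z)\<rceil>"]) measurable

lemma batch_weight_bounds:
  assumes "\<And>k. 1 \<le> k \<Longrightarrow> k \<le> m \<Longrightarrow> 0 \<le> \<alpha> k" "\<And>k. 1 \<le> k \<Longrightarrow> k \<le> m \<Longrightarrow> 0 \<le> \<beta> k"
  shows "0 \<le> batch_weight m t \<alpha> \<beta> n z \<and> batch_weight m t \<alpha> \<beta> n z \<le> 1"
proof -
  have "0 \<le> work_cost m t \<alpha> \<beta> s w / real n" for s w
    by (intro divide_nonneg_nonneg work_cost_nonneg assms) auto
  then show ?thesis unfolding batch_weight_def by (auto intro!: prod_nonneg prod_le_1)
qed

text \<open>Only \<open>N\<close> of the infinitely many coordinates are involved; projecting to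
  them leaves a finite product measure, under which the integral factorises.\<close>

lemma integral_PiM_power:
  fixes f :: "'b \<Rightarrow> real"
  assumes "prob_space W" and f [measurable]: "f \<in> borel_measurable W" and b: "\<And>w. \<bar>f w\<bar> \<le> 1"
  shows "(\<integral>S. (\<Prod>j<N. f (S j)) \<partial>(\<Pi>\<^sub>M j\<in>(UNIV::nat set). W)) = (\<integral>w. f w \<partial>W) ^ N"
proof -
  interpret W: prob_space W by fact
  interpret P: product_prob_space "\<lambda>_::nat. W" UNIV by unfold_locales
  have "(\<integral>S. (\<Prod>j<N. f (S j)) \<partial>(\<Pi>\<^sub>M j\<in>(UNIV::nat set). W)) =
      (\<integral>S. (\<Prod>j<N. f (S j)) \<partial>distr (\<Pi>\<^sub>M j\<in>(UNIV::nat set). W) (\<Pi>\<^sub>M j\<in>{..<N}. W) (\<lambda>x. restrict x {..<N}))"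
    by (subst integral_distr) auto
  also have "\<dots> = (\<integral>S. (\<Prod>j<N. f (S j)) \<partial>(\<Pi>\<^sub>M j\<in>{..<N}. W))"
    by (subst P.distr_PiM_restrict_finite) auto
  also have "\<dots> = (\<Prod>j<N. \<integral>w. f w \<partial>W)"
    by (rule P.product_integral_prod) (auto intro!: W.integrable_const_bound[of _ 1] b)
  finally show ?thesis by simp
qed

text \<open>Given the base size \<open>b\<close>, the works are independent with a common law, so by
  Fubini integrating them first yields a power whose exponent is the batch size.\<close>

lemma integral_batch_weight:
  assumes PB: "prob_space (PB s)" "sets (PB s) = sets borel" and W: "prob_space (W s)" "sets (W s) = sets borel"
    and ab: "\<And>k. 1 \<le> k \<Longrightarrow> k \<le> m \<Longrightarrow> 0 \<le> \<alpha> k" "\<And>k. 1 \<le> k \<Longrightarrow> k \<le> m \<Longrightarrow> 0 \<le> \<beta> k"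
  shows "(\<integral>y. batch_weight m t \<alpha> \<beta> n (s, y) \<partial>mark_law PB W s) =
    (\<integral>b. (\<integral>w. exp (- (work_cost m t \<alpha> \<beta> s w / real n)) \<partial>W s) ^ nat \<lceil>real n * b\<rceil> \<partial>PB s)"
proof -
  interpret B: prob_space "PB s" by fact
  interpret W: prob_space "W s" by fact
  interpret P: product_prob_space "\<lambda>_::nat. W s" UNIV by unfold_locales
  interpret BP: pair_prob_space "PB s" "\<Pi>\<^sub>M j\<in>(UNIV::nat set). W s" by unfold_locales
  note [measurable_cong] = PB(2) W(2)
  have sets: "sets (mark_law PB W s) = sets mark_space"
    unfolding mark_law_def mark_space_def
    by (intro sets_pair_measure_cong sets_PiM_cong PB W refl)
  have "(\<lambda>y. batch_weight m t \<alpha> \<beta> n (s, y)) \<in> borel_measurable mark_space" by simp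
  then have meas: "(\<lambda>y. batch_weight m t \<alpha> \<beta> n (s, y)) \<in> borel_measurable (PB s \<Otimes>\<^sub>M (\<Pi>\<^sub>M j\<in>(UNIV::nat set). W s))"
    using measurable_cong_sets[OF sets refl] unfolding mark_law_def by blast
  have int: "integrable (PB s \<Otimes>\<^sub>M (\<Pi>\<^sub>M j\<in>(UNIV::nat set). W s)) (\<lambda>y. batch_weight m t \<alpha> \<beta> n (s, y))"
    using batch_weight_bounds[OF ab] by (intro BP.integrable_const_bound[OF _ meas, of 1]) (simp add: abs_of_nonneg)
  have "(\<integral>y. batch_weight m t \<alpha> \<beta> n (s, y) \<partial>mark_law PB W s) =
      (\<integral>b. (\<integral>S. batch_weight m t \<alpha> \<beta> n (s, b, S) \<partial>(\<Pi>\<^sub>M j\<in>(UNIV::nat set). W s)) \<partial>PB s)"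
    unfolding mark_law_def using BP.integral_fst'[OF int] by simp
  also have "\<dots> = (\<integral>b. (\<integral>w. exp (- (work_cost m t \<alpha> \<beta> s w / real n)) \<partial>W s) ^ nat \<lceil>real n * b\<rceil> \<partial>PB s)"
    unfolding batch_weight_def fst_conv snd_conv
    by (intro Bochner_Integration.integral_cong refl integral_PiM_power W)
      (auto intro!: divide_nonneg_nonneg work_cost_nonneg ab)
  finally show ?thesis .
qed

section \<open>The limit of a single batch\<close>

lemma tendsto_ceiling_mult_div:
  assumes "0 \<le> b"
  shows "(\<lambda>n. real (nat \<lceil>real n * b\<rceil>) / real n) \<longlonglongrightarrow> b"
proof (rule tendsto_sandwich)
  have *: "real n * b \<le> real (nat \<lceil>real n * b\<rceil>) \<and> real (nat \<lceil>real n * b\<rceil>) \<le> real n * b + 1" for n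
  proof -
    have "0 \<le> real n * b" using assms by simp
    then have "real (nat \<lceil>real n * b\<rceil>) = of_int \<lceil>real n * b\<rceil>" by simp
    then show ?thesis by linarith
  qed
  show "eventually (\<lambda>n. b \<le> real (nat \<lceil>real n * b\<rceil>) / real n) sequentially"
    using eventually_gt_at_top[of 0] by eventually_elim (use * in \<open>simp add: field_simps\<close>)
  show "eventually (\<lambda>n. real (nat \<lceil>real n * b\<rceil>) / real n \<le> b + 1 / real n) sequentially"
    using eventually_gt_at_top[of 0] by eventually_elim (use * in \<open>simp add: field_simps\<close>)
  show "(\<lambda>n. b + 1 / real n) \<longlonglongrightarrow> b"
    using tendsto_add[OF tendsto_const[of b] lim_1_over_n] by simp
qed simp

text \<open>Combines \<open>(1 - y + y^2) * (1 + y) = 1 + y^3\<close>, which is at least 1, with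
  \<open>1 + y \<le> exp y\<close>.\<close>

lemma exp_minus_le_quadratic:
  fixes y :: real
  assumes "0 \<le> y"
  shows "exp (- y) \<le> 1 - y + y\<^sup>2"
proof -
  have "1 \<le> (1 - y + y\<^sup>2) * (1 + y)"
    using assms by (simp add: algebra_simps power2_eq_square)
  also have "\<dots> \<le> (1 - y + y\<^sup>2) * exp y"
  proof (rule mult_left_mono)
    have "1 - y + y\<^sup>2 = (1 - y / 2)\<^sup>2 + 3 / 4 * y\<^sup>2"
      by (simp add: power2_eq_square algebra_simps)
    then show "0 \<le> 1 - y + y\<^sup>2" by simp
  qed simp
  finally show ?thesis by (simp add: exp_minus field_simps)
qed

text \<open>Both bounds on the transform of one scaled cost are exponentials, so raising them to the
  batch size only multiplies their exponents. These are \<open>- c / n\<close> and the same plus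
  \<open>C^2 / n^2\<close>; after multiplication by about \<open>n * b\<close> the correction is of
  order \<open>1 / n\<close>.\<close>

lemma tendsto_laplace_power:
  assumes "prob_space P" and f [measurable]: "f \<in> borel_measurable P"
    and f0: "\<And>w. 0 \<le> f w" and fC: "\<And>w. f w \<le> C" and b: "0 \<le> b"
  shows "(\<lambda>n. (\<integral>w. exp (- (f w / real n)) \<partial>P) ^ nat \<lceil>real n * b\<rceil>) \<longlonglongrightarrow> exp (- (\<integral>w. f w \<partial>P) * b)"
proof -
  interpret prob_space P by fact
  define c where "c = (\<integral>w. f w \<partial>P)"
  let ?N = "\<lambda>n. nat \<lceil>real n * b\<rceil>"
  let ?\<phi> = "\<lambda>n. (\<integral>w. exp (- (f w / real n)) \<partial>P)"
  have C: "0 \<le> C" using f0[of undefined] fC[of undefined] by linarith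
  have intf: "integrable P f" by (rule integrable_const_bound[of _ C]) (simp_all add: f0 fC)
  have inte: "integrable P (\<lambda>w. exp (- (f w / real n)))" for n
    by (rule integrable_const_bound[of _ 1]) (simp_all add: f0)
  \<comment> \<open>Jensen, in the form of the tangent to \<open>exp\<close> at \<open>- c / n\<close>\<close>
  have lower: "exp (- (c / real n)) \<le> ?\<phi> n" for n
  proof -
    let ?a = "c / real n"
    have "exp (- ?a) = (\<integral>w. exp (- ?a) * (1 + ?a - f w / real n) \<partial>P)"
      using intf by (simp add: c_def prob_space)
    also have "\<dots> \<le> ?\<phi> n"
    proof (rule integral_mono[OF _ inte])
      show "integrable P (\<lambda>w. exp (- ?a) * (1 + ?a - f w / real n))" using intf by simp
      fix w
      have "exp (- ?a) * (1 + ?a - f w / real n) \<le> exp (- ?a) * exp (?a - f w / real n)"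
        using exp_ge_add_one_self[of "?a - f w / real n"] by (intro mult_left_mono) (linarith, simp)
      also have "\<dots> = exp (- (f w / real n))" by (simp flip: exp_add)
      finally show "exp (- ?a) * (1 + ?a - f w / real n) \<le> exp (- (f w / real n))" .
    qed
    finally show ?thesis .
  qed
  have upper: "?\<phi> n \<le> exp (- (c / real n) + C\<^sup>2 / (real n)\<^sup>2)" for n
  proof -
    have "?\<phi> n \<le> (\<integral>w. 1 - f w / real n + C\<^sup>2 / (real n)\<^sup>2 \<partial>P)"
    proof (rule integral_mono[OF inte])
      show "integrable P (\<lambda>w. 1 - f w / real n + C\<^sup>2 / (real n)\<^sup>2)" using intf by simp
      fix w
      have "exp (- (f w / real n)) \<le> 1 - f w / real n + (f w / real n)\<^sup>2"
        using f0 by (intro exp_minus_le_quadratic) simp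
      also have "(f w / real n)\<^sup>2 \<le> (C / real n)\<^sup>2"
        using f0 fC by (intro power_mono divide_right_mono) auto
      finally show "exp (- (f w / real n)) \<le> 1 - f w / real n + C\<^sup>2 / (real n)\<^sup>2"
        by (simp add: power_divide)
    qed
    also have "\<dots> = 1 + (- (c / real n) + C\<^sup>2 / (real n)\<^sup>2)"
      using intf by (simp add: c_def prob_space)
    also have "\<dots> \<le> exp (- (c / real n) + C\<^sup>2 / (real n)\<^sup>2)" by (rule exp_ge_add_one_self)
    finally show ?thesis .
  qed
  have lim: "(\<lambda>n. real (?N n) / real n) \<longlonglongrightarrow> b" by (rule tendsto_ceiling_mult_div[OF b])
  have "(\<lambda>n. ?\<phi> n ^ ?N n) \<longlonglongrightarrow> exp (- (c * b))"
  proof (rule tendsto_sandwich)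
    \<comment> \<open>This holds at \<open>n = 0\<close> as well: exponent and batch size are both 0
      there, division by 0 being 0.\<close>
    show "eventually (\<lambda>n. exp (- (c * (real (?N n) / real n))) \<le> ?\<phi> n ^ ?N n) sequentially"
    proof (rule always_eventually, rule allI)
      fix n
      have "exp (- (c * (real (?N n) / real n))) = exp (- (c / real n)) ^ ?N n"
        by (simp add: exp_of_nat_mult[symmetric] field_simps)
      also have "\<dots> \<le> ?\<phi> n ^ ?N n" by (intro power_mono lower) simp
      finally show "exp (- (c * (real (?N n) / real n))) \<le> ?\<phi> n ^ ?N n" .
    qed
    show "eventually (\<lambda>n. ?\<phi> n ^ ?N n \<le>
        exp (- (c * (real (?N n) / real n)) + C\<^sup>2 * (real (?N n) / real n * (1 / real n)))) sequentially"
    proof (rule always_eventually, rule allI)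
      fix n
      have "?\<phi> n ^ ?N n \<le> exp (- (c / real n) + C\<^sup>2 / (real n)\<^sup>2) ^ ?N n"
        by (intro power_mono upper integral_nonneg_AE) simp
      also have "\<dots> = exp (real (?N n) * (- (c / real n) + C\<^sup>2 / (real n)\<^sup>2))"
        by (rule exp_of_nat_mult[symmetric])
      also have "real (?N n) * (- (c / real n) + C\<^sup>2 / (real n)\<^sup>2) =
          - (c * (real (?N n) / real n)) + C\<^sup>2 * (real (?N n) / real n * (1 / real n))"
        by (simp add: power2_eq_square algebra_simps)
      finally show "?\<phi> n ^ ?N n \<le>
        exp (- (c * (real (?N n) / real n)) + C\<^sup>2 * (real (?N n) / real n * (1 / real n)))" .
    qed
    show "(\<lambda>n. exp (- (c * (real (?N n) / real n)))) \<longlonglongrightarrow> exp (- (c * b))"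
      by (intro tendsto_intros lim)
    have "(\<lambda>n. exp (- (c * (real (?N n) / real n)) + C\<^sup>2 * (real (?N n) / real n * (1 / real n)))) \<longlonglongrightarrow>
        exp (- (c * b) + C\<^sup>2 * (b * 0))"
      by (intro tendsto_intros lim lim_1_over_n)
    then show "(\<lambda>n. exp (- (c * (real (?N n) / real n)) + C\<^sup>2 * (real (?N n) / real n * (1 / real n)))) \<longlonglongrightarrow>
        exp (- (c * b))" by simp
  qed
  then show ?thesis by (simp add: c_def)
qed

text \<open>A positive arrival time and nonnegative work make \<open>0 < s + w\<close> hold almost
  surely, so being present and having departed are complementary events, decided by
  \<open>w \<le> t x - s\<close>. Positivity of \<open>s\<close> matters: zero work at time 0 would
  be counted in neither.\<close>

lemma integral_work_cost:
  assumes "prob_space (W s)" and sW [measurable_cong]: "sets (W s) = sets borel"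
    and W0: "AE x in W s. 0 \<le> x" and s: "0 < s"
  shows "(\<integral>w. work_cost m t \<alpha> \<beta> s w \<partial>W s) =
    (\<Sum>x=1..m. if s \<le> t x then \<alpha> x * (1 - cdf_of (W s) (t x - s)) + \<beta> x * cdf_of (W s) (t x - s) else 0)"
proof -
  interpret prob_space "W s" by fact
  have sp: "space (W s) = UNIV" using sets_eq_imp_space_eq[OF sW] by simp
  have int: "integrable (W s) (indicator B :: real \<Rightarrow> real)" if "B \<in> sets borel" for B
    using that by (intro integrable_const_bound[of _ 1]) (auto simp: indicator_def sW)
  have "(\<integral>w. work_cost m t \<alpha> \<beta> s w \<partial>W s) =
      (\<integral>w. (\<Sum>x=1..m. if s \<le> t x then \<alpha> x * (1 - indicator {..t x - s} w) + \<beta> x * indicator {..t x - s} w else 0) \<partial>W s)"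
  proof (rule integral_cong_AE)
    show "AE w in W s. work_cost m t \<alpha> \<beta> s w =
        (\<Sum>x=1..m. if s \<le> t x then \<alpha> x * (1 - indicator {..t x - s} w) + \<beta> x * indicator {..t x - s} w else 0)"
      using W0
    proof eventually_elim
      case (elim w)
      then have "t x < s + w \<longleftrightarrow> \<not> w \<le> t x - s" "0 < s + w \<and> s + w \<le> t x \<longleftrightarrow> w \<le> t x - s" for x
        using s by auto
      then show ?case
        unfolding work_cost_def by (intro sum.cong refl) (auto simp: of_bool_def indicator_def)
    qed
  qed simp_all
  also have "\<dots> = (\<Sum>x=1..m. \<integral>w. (if s \<le> t x then \<alpha> x * (1 - indicator {..t x - s} w) + \<beta> x * indicator {..t x - s} w else 0) \<partial>W s)"
  proof (rule Bochner_Integration.integral_sum)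
    show "integrable (W s) (\<lambda>w. if s \<le> t x then \<alpha> x * (1 - indicator {..t x - s} w) + \<beta> x * indicator {..t x - s} w else 0)" for x
      by (cases "s \<le> t x") (simp_all add: int)
  qed
  also have "\<dots> = (\<Sum>x=1..m. if s \<le> t x then \<alpha> x * (1 - cdf_of (W s) (t x - s)) + \<beta> x * cdf_of (W s) (t x - s) else 0)"
    by (intro sum.cong refl) (auto simp: int prob_space[unfolded sp] cdf_of_def sp)
  finally show ?thesis .
qed

section \<open>Cutting time integrals at the observation times\<close>

lemma set_integral_Ioc_eq_Icc:
  fixes f :: "real \<Rightarrow> real"
  assumes "a \<le> b" and f: "set_integrable lborel {a<..b} f"
  shows "(LINT x:{a..b}|lborel. f x) = (LINT x:{a<..b}|lborel. f x)"
proof -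
  have "indicator {a..b} x *\<^sub>R f x = indicator {a<..b} x *\<^sub>R f x + indicator {a} x *\<^sub>R f a" for x
    using assms(1) by (auto simp: indicator_def)
  then show ?thesis
    using f unfolding set_lebesgue_integral_def set_integrable_def
    by (simp add: Bochner_Integration.integral_add)
qed

lemma set_integral_Ioc_partition:
  fixes f :: "real \<Rightarrow> real"
  assumes f: "set_integrable lborel {t 0<..t m} f" and mono: "\<And>k. k < m \<Longrightarrow> t k \<le> t (Suc k)"
  shows "(LINT s:{t 0<..t m}|lborel. f s) = (\<Sum>k=1..m. LINT s:{t (k - 1)<..t k}|lborel. f s)"
  using assms
proof (induction m)
  case 0
  then show ?case by (simp add: set_lebesgue_integral_def)
next
  case (Suc m)
  have t0: "t 0 \<le> t j" if "j \<le> m" for j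
    using that
  proof (induction j)
    case (Suc j)
    then show ?case using Suc.prems Suc.IH \<open>\<And>k. k < Suc m \<Longrightarrow> t k \<le> t (Suc k)\<close>[of j] by linarith
  qed simp
  have tm: "t 0 \<le> t m" "t m \<le> t (Suc m)" using t0[of m] Suc.prems(2)[of m] by auto
  have un: "{t 0<..t (Suc m)} = {t 0<..t m} \<union> {t m<..t (Suc m)}" using tm by auto
  have i1: "set_integrable lborel {t 0<..t m} f"
    by (rule set_integrable_subset[OF Suc.prems(1)]) (use tm in auto)
  have i2: "set_integrable lborel {t m<..t (Suc m)} f"
    by (rule set_integrable_subset[OF Suc.prems(1)]) (use tm in auto)
  have "(LINT s:{t 0<..t (Suc m)}|lborel. f s) =
      (LINT s:{t 0<..t m}|lborel. f s) + (LINT s:{t m<..t (Suc m)}|lborel. f s)"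
    unfolding un by (rule set_integral_Un[OF _ i1 i2]) auto
  also have "(LINT s:{t 0<..t m}|lborel. f s) = (\<Sum>k=1..m. LINT s:{t (k - 1)<..t k}|lborel. f s)"
    by (rule Suc.IH[OF i1]) (simp add: Suc.prems(2))
  finally show ?case by simp
qed

section \<open>Passage to the limit and its form on the blocks between observation times\<close>

theorem theorem4:
  fixes lam :: "real \<Rightarrow> real"
    and PB W :: "real \<Rightarrow> real measure"
    and M :: "nat \<Rightarrow> 'a measure"
    and A :: "nat \<Rightarrow> real \<Rightarrow> 'a \<Rightarrow> nat"
    and Bm :: "nat \<Rightarrow> nat \<Rightarrow> 'a \<Rightarrow> real"
    and S :: "nat \<Rightarrow> nat \<Rightarrow> nat \<Rightarrow> 'a \<Rightarrow> real"
    and m :: nat and t \<alpha> \<beta> :: "nat \<Rightarrow> real"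
  assumes lam_meas: "lam \<in> borel_measurable lborel"
    and lam_nonneg: "\<And>s. 0 \<le> s \<Longrightarrow> 0 \<le> lam s"
    and lam_loc_int: "\<And>T. 0 \<le> T \<Longrightarrow> set_integrable lborel {0..T} lam"
    and PB_kernel: "PB \<in> borel \<rightarrow>\<^sub>M prob_algebra borel"
    and PB_nonneg: "\<And>s. 0 \<le> s \<Longrightarrow> AE b in PB s. 0 \<le> b"
    and W_kernel: "W \<in> borel \<rightarrow>\<^sub>M prob_algebra borel"
    and W_nonneg: "\<And>s. 0 \<le> s \<Longrightarrow> AE x in W s. 0 \<le> x"
    and model: "\<And>n. 1 \<le> n \<Longrightarrow> marked_arrivals (M n) lam PB W (A n) (Bm n) (S n)"
    and m_pos: "1 \<le> m"
    and t0: "t 0 = 0"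
    and t_incr: "\<And>k. k < m \<Longrightarrow> t k < t (Suc k)"
    and \<alpha>_nonneg: "\<And>k. 1 \<le> k \<Longrightarrow> k \<le> m \<Longrightarrow> 0 \<le> \<alpha> k"
    and \<beta>_nonneg: "\<And>k. 1 \<le> k \<Longrightarrow> k \<le> m \<Longrightarrow> 0 \<le> \<beta> k"
  shows "(\<lambda>n. \<integral>\<omega>. exp (- (\<Sum>k=1..m.
              \<alpha> k * (real (queue_len n (A n) (Bm n) (S n) (t k) \<omega>) / real n) +
              \<beta> k * (real (departures n (A n) (Bm n) (S n) (t k) \<omega>) / real n))) \<partial>(M n))
         \<longlonglongrightarrow>
         exp (- (\<Sum>k=1..m. LINT s:{t (k - 1)..t k}|lborel.
              (\<integral>b. 1 - exp (- (\<Sum>x=k..m. \<alpha> x * (1 - cdf_of (W s) (t x - s)) +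
                                         \<beta> x * cdf_of (W s) (t x - s)) * b) \<partial>(PB s)) * lam s))"
proof -
  have lam_borel [measurable]: "lam \<in> borel_measurable borel" using lam_meas by simp
  have t_less: "t i < t j" if "i < j" "j \<le> m" for i j
    using that
  proof (induction j)
    case (Suc j)
    then show ?case using t_incr[of j] by (cases "i = j") auto
  qed simp
  have t_mono: "t i \<le> t j" if "i \<le> j" "j \<le> m" for i j
    using t_less[of i j] that by (cases "i = j") auto
  define T where "T = t m"
  have T: "0 < T" using t_less[of 0 m] m_pos t0 by (simp add: T_def)
  note ab = \<alpha>_nonneg \<beta>_nonneg
  have PB: "prob_space (PB s)" "sets (PB s) = sets borel" for s
    using measurable_space[OF PB_kernel, of s] by (auto simp: space_prob_algebra)
  have W: "prob_space (W s)" "sets (W s) = sets borel" for s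
    using measurable_space[OF W_kernel, of s] by (auto simp: space_prob_algebra)
  \<comment> \<open>\<open>G n s\<close> is the mean weight of a batch arriving at \<open>s\<close>,
    \<open>c s\<close> the mean cost of one of its customers, and \<open>L s\<close> the Laplace
    transform of \<open>PB s\<close> at \<open>c s\<close>, which is the limit of
    \<open>G n s\<close> for positive \<open>s\<close>.\<close>
  define G where "G n s = (\<integral>y. batch_weight m t \<alpha> \<beta> n (s, y) \<partial>mark_law PB W s)" for n s
  define c where "c s = (\<integral>w. work_cost m t \<alpha> \<beta> s w \<partial>W s)" for s
  define L where "L s = (\<integral>b. exp (- c s * b) \<partial>PB s)" for s
  have G_eq: "G n s = (\<integral>b. (\<integral>w. exp (- (work_cost m t \<alpha> \<beta> s w / real n)) \<partial>W s) ^ nat \<lceil>real n * b\<rceil> \<partial>PB s)" for n s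
    unfolding G_def by (rule integral_batch_weight[OF PB W ab])
  have G_meas [measurable]: "G n \<in> borel_measurable borel" for n
    unfolding G_def[abs_def]
    using batch_weight_bounds[where t = t and n = n, OF ab]
    by (intro measurable_integral_kernel[OF measurable_mark_law[OF PB_kernel W_kernel]]) auto
  have phi01: "0 \<le> (\<integral>w. exp (- (work_cost m t \<alpha> \<beta> s w / real n)) \<partial>W s)"
    "(\<integral>w. exp (- (work_cost m t \<alpha> \<beta> s w / real n)) \<partial>W s) \<le> 1" for n s
  proof -
    interpret prob_space "W s" by (rule W)
    note [measurable_cong] = W(2)
    have le1: "exp (- (work_cost m t \<alpha> \<beta> s w / real n)) \<le> 1" for w
      using work_cost_nonneg[where t = t and s = s and w = w, OF ab] by simp
    have "integrable (W s) (\<lambda>w. exp (- (work_cost m t \<alpha> \<beta> s w / real n)))"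
      by (rule integrable_const_bound[of _ 1]) (simp_all only: real_norm_def abs_exp_cancel le1 AE_I2, measurable)
    then have "(\<integral>w. exp (- (work_cost m t \<alpha> \<beta> s w / real n)) \<partial>W s) \<le> (\<integral>w. 1 \<partial>W s)"
      by (rule integral_mono) (simp_all only: le1 integrable_const)
    then show "(\<integral>w. exp (- (work_cost m t \<alpha> \<beta> s w / real n)) \<partial>W s) \<le> 1" by (simp add: prob_space)
    show "0 \<le> (\<integral>w. exp (- (work_cost m t \<alpha> \<beta> s w / real n)) \<partial>W s)"
      by (rule integral_nonneg_AE) simp
  qed
  have int_pow: "integrable (PB s) (\<lambda>b. (\<integral>w. exp (- (work_cost m t \<alpha> \<beta> s w / real n)) \<partial>W s) ^ nat \<lceil>real n * b\<rceil>)" for n s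
  proof -
    interpret prob_space "PB s" by (rule PB)
    note [measurable_cong] = PB(2)
    show ?thesis
      by (rule integrable_const_bound[of _ 1]) (auto simp: phi01 power_le_one)
  qed
  have G01: "0 \<le> G n s" "G n s \<le> 1" for n s
  proof -
    interpret prob_space "PB s" by (rule PB)
    show "0 \<le> G n s" unfolding G_eq by (rule integral_nonneg_AE) (simp add: phi01)
    have "G n s \<le> (\<integral>b. 1 \<partial>PB s)"
      unfolding G_eq by (rule integral_mono[OF int_pow]) (simp_all add: phi01 power_le_one)
    then show "G n s \<le> 1" by (simp add: prob_space)
  qed
  have G_lim: "(\<lambda>n. G n s) \<longlonglongrightarrow> L s" if s: "0 < s" for s
    unfolding G_eq L_def
  proof (rule integral_dominated_convergence[where w = "\<lambda>_. 1"])
    interpret prob_space "PB s" by (rule PB)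
    show "integrable (PB s) (\<lambda>_. 1 :: real)" by simp
    show "(\<lambda>b. exp (- c s * b)) \<in> borel_measurable (PB s)"
      by (subst measurable_cong_sets[OF PB(2) refl]) simp
    show "(\<lambda>b. (\<integral>w. exp (- (work_cost m t \<alpha> \<beta> s w / real n)) \<partial>W s) ^ nat \<lceil>real n * b\<rceil>) \<in> borel_measurable (PB s)" for n
      by (rule borel_measurable_integrable[OF int_pow])
    show "AE b in PB s. norm ((\<integral>w. exp (- (work_cost m t \<alpha> \<beta> s w / real n)) \<partial>W s) ^ nat \<lceil>real n * b\<rceil>) \<le> 1" for n
      by (intro AE_I2) (simp add: phi01 power_le_one)
    have wm: "work_cost m t \<alpha> \<beta> s \<in> borel_measurable (W s)"
      by (subst measurable_cong_sets[OF W(2) refl]) (simp add: work_cost_measurable2)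
    have "AE b in PB s. 0 \<le> b" using s by (intro PB_nonneg) simp
    then show "AE b in PB s. (\<lambda>n. (\<integral>w. exp (- (work_cost m t \<alpha> \<beta> s w / real n)) \<partial>W s) ^ nat \<lceil>real n * b\<rceil>) \<longlonglongrightarrow> exp (- c s * b)"
    proof eventually_elim
      case (elim b)
      show ?case unfolding c_def
        by (rule tendsto_laplace_power[OF W(1) wm work_cost_nonneg[OF ab] work_cost_le[OF ab] elim])
    qed
  qed
  define f where "f s = (1 - L s) * lam s" for s
  \<comment> \<open>The left end 0 is dropped because the convergence of \<open>G n\<close> and the
    formula for \<open>c\<close> are established for positive times.\<close>
  define g where "g n s = indicator {0<..T} s *\<^sub>R ((1 - G n s) * lam s)" for n s
  have g_lim: "(\<lambda>n. g n s) \<longlonglongrightarrow> indicator {0<..T} s *\<^sub>R f s" for s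
    unfolding g_def f_def by (cases "0 < s") (auto intro!: tendsto_intros G_lim)
  have g_meas [measurable]: "g n \<in> borel_measurable lborel" for n
    unfolding g_def by measurable
  \<comment> \<open>Measurability passes from the prelimit functions to their pointwise limit, so
    \<open>c\<close> and the distribution functions never have to be studied as functions of
    \<open>s\<close>.\<close>
  have f_meas [measurable]: "(\<lambda>s. indicator {0<..T} s *\<^sub>R f s) \<in> borel_measurable lborel"
    by (rule borel_measurable_LIMSEQ_real[OF g_lim g_meas])
  have lamT: "integrable lborel (\<lambda>s. indicator {0..T} s *\<^sub>R lam s)"
    using lam_loc_int[of T] T by (simp add: set_integrable_def)
  have g_bound: "AE s in lborel. norm (g n s) \<le> indicator {0..T} s *\<^sub>R lam s" for n
    using G01[of n] lam_nonneg
    by (intro AE_I2) (auto simp: g_def indicator_def abs_mult intro!: mult_left_le_one_le)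
  \<comment> \<open>In order: convergence of the integrals, integrability of the limit,
    integrability of each \<open>g n\<close>, all under the bound \<open>lam\<close> on
    \<open>{0..T}\<close>.\<close>
  note dct = integral_dominated_convergence[OF f_meas g_meas lamT AE_I2[OF g_lim] g_bound]
    integrable_dominated_convergence[OF f_meas g_meas lamT AE_I2[OF g_lim] g_bound]
    integrable_dominated_convergence2[OF f_meas g_meas lamT AE_I2[OF g_lim] g_bound]
  have f_int: "set_integrable lborel {0<..T} f"
    unfolding set_integrable_def by (rule dct(2))
  \<comment> \<open>For each fixed \<open>n\<close> the transform is explicit, so the only limit
    taken is that of a deterministic integral; the probability spaces \<open>M n\<close> may be
    unrelated to each other.\<close>
  have pre_limit: "(\<integral>\<omega>. exp (- (\<Sum>k=1..m.
              \<alpha> k * (real (queue_len n (A n) (Bm n) (S n) (t k) \<omega>) / real n) +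
              \<beta> k * (real (departures n (A n) (Bm n) (S n) (t k) \<omega>) / real n))) \<partial>(M n)) =
      exp (- (\<integral>s. g n s \<partial>lborel))" if n: "1 \<le> n" for n
  proof -
    interpret poisson_stream "M n" lam "A n"
      by (rule marked_arrivals_poisson_stream[OF model[OF n] lam_borel lam_nonneg lam_loc_int])
    interpret marked_stream "M n" lam "A n" PB W "Bm n" "S n"
      by unfold_locales (fact model[OF n] PB_kernel W_kernel)+
    have "(\<integral>\<omega>. exp (- (\<Sum>k=1..m.
              \<alpha> k * (real (queue_len n (A n) (Bm n) (S n) (t k) \<omega>) / real n) +
              \<beta> k * (real (departures n (A n) (Bm n) (S n) (t k) \<omega>) / real n))) \<partial>(M n)) =
        expectation (\<lambda>\<omega>. \<Prod>k<A n T \<omega>. batch_weight m t \<alpha> \<beta> n (arr_time (\<lambda>u. A n u \<omega>) k, mark k \<omega>))"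
    proof (intro Bochner_Integration.integral_cong refl exp_cost_eq_prod_batch_weight path)
      show "0 \<le> t k \<and> t k \<le> T" if "1 \<le> k" "k \<le> m" for k
        using t_mono[of 0 k] t_mono[of k m] that by (simp add: t0 T_def)
    qed
    also have "\<dots> = exp (- (LINT s:{0..T}|lborel. (1 - G n s) * lam s))"
      unfolding G_def
      by (rule marked_poisson_functional[OF T batch_weight_measurable batch_weight_bounds[OF ab]])
    also have "(LINT s:{0..T}|lborel. (1 - G n s) * lam s) = (LINT s:{0<..T}|lborel. (1 - G n s) * lam s)"
      using T dct(3)[of n] by (intro set_integral_Ioc_eq_Icc) (simp_all add: set_integrable_def g_def)
    finally show ?thesis by (simp add: set_lebesgue_integral_def g_def)
  qed
  have "(\<lambda>n. exp (- (\<integral>s. g n s \<partial>lborel))) \<longlonglongrightarrow> exp (- (LINT s:{0<..T}|lborel. f s))"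
    unfolding set_lebesgue_integral_def by (intro tendsto_intros dct(1))
  moreover have "(LINT s:{0<..T}|lborel. f s) = (\<Sum>k=1..m. LINT s:{t (k - 1)..t k}|lborel.
              (\<integral>b. 1 - exp (- (\<Sum>x=k..m. \<alpha> x * (1 - cdf_of (W s) (t x - s)) +
                                         \<beta> x * cdf_of (W s) (t x - s)) * b) \<partial>(PB s)) * lam s)"
  proof -
    have "(LINT s:{0<..T}|lborel. f s) = (\<Sum>k=1..m. LINT s:{t (k - 1)<..t k}|lborel. f s)"
      using set_integral_Ioc_partition[where t = t and m = m and f = f, OF _ less_imp_le[OF t_incr]] f_int
      unfolding t0 T_def by blast
    also have "\<dots> = (\<Sum>k=1..m. LINT s:{t (k - 1)..t k}|lborel.
              (\<integral>b. 1 - exp (- (\<Sum>x=k..m. \<alpha> x * (1 - cdf_of (W s) (t x - s)) +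
                                         \<beta> x * cdf_of (W s) (t x - s)) * b) \<partial>(PB s)) * lam s)"
    proof (rule sum.cong[OF refl])
      fix k assume k: "k \<in> {1..m}"
      let ?h = "\<lambda>s. (\<integral>b. 1 - exp (- (\<Sum>x=k..m. \<alpha> x * (1 - cdf_of (W s) (t x - s)) +
                                         \<beta> x * cdf_of (W s) (t x - s)) * b) \<partial>(PB s)) * lam s"
      have tk: "t 0 \<le> t (k - 1)" "t (k - 1) \<le> t k" "t k \<le> T"
        unfolding T_def using k t_mono[of 0 "k - 1"] t_mono[of "k - 1" k] t_mono[of k m] by auto
      have eq: "f s = ?h s" if s: "s \<in> {t (k - 1)<..t k}" for s
      proof -
        have s0: "0 < s" using s tk t0 by auto
        \<comment> \<open>On block \<open>k\<close> the observation times not before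
          \<open>s\<close> are exactly those with index at least \<open>k\<close>; this gives the
          inner sum its lower limit.\<close>
        have iff: "s \<le> t x \<longleftrightarrow> k \<le> x" if "x \<in> {1..m}" for x
        proof
          assume "k \<le> x"
          then have "t k \<le> t x" using that by (intro t_mono) auto
          then show "s \<le> t x" using s by simp
        next
          assume sx: "s \<le> t x"
          show "k \<le> x"
          proof (rule ccontr)
            assume "\<not> k \<le> x"
            then have "t x \<le> t (k - 1)" using k by (intro t_mono) auto
            with s sx show False by simp
          qed
        qed
        have "c s = (\<Sum>x=1..m. if s \<le> t x then \<alpha> x * (1 - cdf_of (W s) (t x - s)) + \<beta> x * cdf_of (W s) (t x - s) else 0)"
          unfolding c_def using s0 by (intro integral_work_cost W W_nonneg) simp_all
        also have "\<dots> = (\<Sum>x\<in>{x\<in>{1..m}. k \<le> x}. \<alpha> x * (1 - cdf_of (W s) (t x - s)) + \<beta> x * cdf_of (W s) (t x - s))"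
          by (subst sum.inter_filter) (auto simp: iff intro!: sum.cong)
        also have "{x\<in>{1..m}. k \<le> x} = {k..m}" using k by auto
        finally have cs: "c s = (\<Sum>x=k..m. \<alpha> x * (1 - cdf_of (W s) (t x - s)) + \<beta> x * cdf_of (W s) (t x - s))" .
        have c0: "0 \<le> c s"
          unfolding c_def by (rule integral_nonneg_AE) (simp add: work_cost_nonneg[OF ab])
        interpret prob_space "PB s" by (rule PB)
        \<comment> \<open>Nonnegative base sizes keep \<open>exp (- c s * b)\<close> at most 1; the
          resulting integrability lets the constant 1 move inside the expectation.\<close>
        have "AE b in PB s. 0 \<le> b" using s0 by (intro PB_nonneg) simp
        then have "AE b in PB s. norm (exp (- c s * b)) \<le> 1"
          by eventually_elim (simp add: c0)
        moreover have "(\<lambda>b. exp (- c s * b)) \<in> borel_measurable (PB s)"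
          by (subst measurable_cong_sets[OF PB(2) refl]) simp
        ultimately have "integrable (PB s) (\<lambda>b. exp (- c s * b))"
          by (rule integrable_const_bound)
        then have "1 - L s = (\<integral>b. 1 - exp (- c s * b) \<partial>PB s)"
          unfolding L_def by (subst Bochner_Integration.integral_diff) (simp_all add: prob_space)
        then show ?thesis unfolding f_def cs by simp
      qed
      have fk: "set_integrable lborel {t (k - 1)<..t k} f"
        by (rule set_integrable_subset[OF f_int]) (use tk t0 in auto)
      have "set_integrable lborel {t (k - 1)<..t k} ?h"
        using fk by (subst (asm) set_integrable_cong[OF refl refl eq])
      \<comment> \<open>The claim integrates over closed blocks, whose left ends are outside the
        range of \<open>eq\<close>; adding one point leaves the integral unchanged.\<close>
      then have "(LINT s:{t (k - 1)..t k}|lborel. ?h s) = (LINT s:{t (k - 1)<..t k}|lborel. ?h s)"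
        by (rule set_integral_Ioc_eq_Icc[OF tk(2)])
      moreover have "(LINT s:{t (k - 1)<..t k}|lborel. f s) = (LINT s:{t (k - 1)<..t k}|lborel. ?h s)"
        by (rule set_lebesgue_integral_cong) (use eq in auto)
      ultimately show "(LINT s:{t (k - 1)<..t k}|lborel. f s) = (LINT s:{t (k - 1)..t k}|lborel. ?h s)"
        by simp
    qed
    finally show ?thesis .
  qed
  ultimately have lim: "(\<lambda>n. exp (- (\<integral>s. g n s \<partial>lborel))) \<longlonglongrightarrow>
         exp (- (\<Sum>k=1..m. LINT s:{t (k - 1)..t k}|lborel.
              (\<integral>b. 1 - exp (- (\<Sum>x=k..m. \<alpha> x * (1 - cdf_of (W s) (t x - s)) +
                                         \<beta> x * cdf_of (W s) (t x - s)) * b) \<partial>(PB s)) * lam s))"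
    by (simp only:)
  show ?thesis
  \<comment> \<open>The explicit form is available from \<open>n = 1\<close> on, where
    \<open>model\<close> applies.\<close>
  proof (rule Lim_transform_eventually[OF lim])
    show "eventually (\<lambda>n. exp (- (\<integral>s. g n s \<partial>lborel)) = (\<integral>\<omega>. exp (- (\<Sum>k=1..m.
              \<alpha> k * (real (queue_len n (A n) (Bm n) (S n) (t k) \<omega>) / real n) +
              \<beta> k * (real (departures n (A n) (Bm n) (S n) (t k) \<omega>) / real n))) \<partial>(M n))) sequentially"
      using eventually_ge_at_top[of 1] by eventually_elim (rule pre_limit[symmetric])
  qed
qed

end
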